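(* Let $(\Sigma,\eta)$ be a contact Hamiltonian manifold and let $\Lambda\subset\Sigma$ be a nonempty compact invariant set of the characteristic foliation that is Liouville. Then $\Lambda$ is not both positive and negative.
   Context: A contact Hamiltonian structure $\eta$ on an oriented $2n$-manifold $\Sigma$ is an equivalence class, modulo multiplication by positive smooth functions, of 1-forms $\lambda$ (contact Hamiltonian forms) with $(d\lambda)^n\neq0$ at every point where $\lambda\wedge(d\lambda)^{n-1}=0$. The characteristic foliation is the singular line field (vector field modulo multiplication by positive smooth functions) spanned by the vector field $Z$ with $\iota_Z\mu=\lambda\wedge(d\lambda)^{n-1}$, where $\mu$ is a positive volume form. A subset $\Lambda\subset\Sigma$ is Liouville if there is a contact Hamiltonian form $\lambda$ for $\eta$ whose restriction to a neighborhood of $\Lambda$ is a Liouville form ($d\lambda$ is symplectic there); it is positive if $\lambda$ can be chosen so that $(d\lambda)^n$ induces the orientation of $\Sigma$ near $\Lambda$, and negative if $\lambda$ can be chosen so that it induces the opposite orientation. *)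

theory Defs
  imports "HOL-Analysis.Analysis" "HOL-Combinatorics.Permutations"
begin

section \<open>Smooth maps on open subsets of Euclidean spaces\<close>

primrec C_k_on :: "nat \<Rightarrow> 'a::real_normed_vector set \<Rightarrow> ('a \<Rightarrow> 'b::real_normed_vector) \<Rightarrow> bool" where
  "C_k_on 0 S f \<longleftrightarrow> continuous_on S f"
| "C_k_on (Suc k) S f \<longleftrightarrow>
     (\<forall>x\<in>S. f differentiable (at x)) \<and> (\<forall>v. C_k_on k S (\<lambda>x. frechet_derivative f (at x) v))"

definition smooth_on :: "'a::real_normed_vector set \<Rightarrow> ('a \<Rightarrow> 'b::real_normed_vector) \<Rightarrow> bool" where
  "smooth_on S f \<longleftrightarrow> (\<forall>k. C_k_on k S f)"


section \<open>Exterior algebra of a real vector space\<close>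

text \<open>A \<open>k\<close>-form takes a list of \<open>k\<close> vectors. On lists of any other length it is
  required to be \<open>0\<close>, so that equality of \<open>k\<close>-forms is equality of functions and the
  zero form is \<open>\<lambda>_. 0\<close>.\<close>

type_synonym 'e mform = "'e list \<Rightarrow> real"

definition alternating_form :: "nat \<Rightarrow> 'e::real_vector mform \<Rightarrow> bool" where
  "alternating_form k \<alpha> \<longleftrightarrow>
     (\<forall>vs. length vs \<noteq> k \<longrightarrow> \<alpha> vs = 0) \<and>
     (\<forall>vs i. length vs = k \<and> i < k \<longrightarrow> linear (\<lambda>v. \<alpha> (vs[i := v]))) \<and>
     (\<forall>vs i j. length vs = k \<and> i < j \<and> j < k \<and> vs ! i = vs ! j \<longrightarrow> \<alpha> vs = 0)"

definition wedge :: "nat \<Rightarrow> nat \<Rightarrow> 'e mform \<Rightarrow> 'e mform \<Rightarrow> 'e mform" where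
  "wedge k l \<alpha> \<beta> = (\<lambda>vs.
     if length vs = k + l
     then (\<Sum>\<sigma> | \<sigma> permutes {..<k + l}.
             of_int (sign \<sigma>) * \<alpha> (take k (permute_list \<sigma> vs)) * \<beta> (drop k (permute_list \<sigma> vs)))
          / (fact k * fact l)
     else 0)"

text \<open>The powers of a 2-form; the zeroth power is the 0-form \<open>1\<close>.\<close>

primrec form2_power :: "'e mform \<Rightarrow> nat \<Rightarrow> 'e mform" where
  "form2_power \<omega> 0 = (\<lambda>vs. if vs = [] then 1 else 0)"
| "form2_power \<omega> (Suc k) = wedge 2 (2 * k) \<omega> (form2_power \<omega> k)"

definition interior_mult :: "'e \<Rightarrow> 'e mform \<Rightarrow> 'e mform" where
  "interior_mult v \<omega> = (\<lambda>vs. \<omega> (v # vs))"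

text \<open>For constant vector fields \<open>v\<^sub>0, \<dots>, v\<^sub>k\<close> all brackets vanish, and
  \<open>d\<omega>(v\<^sub>0, \<dots>, v\<^sub>k)\<close> is the alternating sum of the derivatives in direction \<open>v\<^sub>i\<close> of
  \<open>\<omega>\<close> evaluated on the remaining vectors.\<close>

definition ext_deriv :: "('e::real_normed_vector \<Rightarrow> 'e mform) \<Rightarrow> 'e \<Rightarrow> 'e mform" where
  "ext_deriv \<omega> x = (\<lambda>vs. \<Sum>i<length vs.
     (-1) ^ i * frechet_derivative (\<lambda>y. \<omega> y (take i vs @ drop (Suc i) vs)) (at x) (vs ! i))"


section \<open>Smooth manifolds\<close>

text \<open>A chart is a pair of its domain and its coordinate map. A manifold is the whole of a Hausdorff
  second countable type together with an atlas \<open>A\<close> with smooth transition maps (not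
  necessarily maximal); its dimension is that of the model space \<open>'e\<close>.\<close>

type_synonym ('m, 'e) chart = "'m set \<times> ('m \<Rightarrow> 'e)"

definition chart_inv :: "('m, 'e) chart \<Rightarrow> 'e \<Rightarrow> 'm" where
  "chart_inv c = inv_into (fst c) (snd c)"

definition chart_image :: "('m, 'e) chart \<Rightarrow> 'e set" where
  "chart_image c = snd c ` fst c"

definition is_chart :: "('m::topological_space, 'e::euclidean_space) chart \<Rightarrow> bool" where
  "is_chart c \<longleftrightarrow> open (fst c) \<and> open (chart_image c) \<and>
     homeomorphism (fst c) (chart_image c) (snd c) (chart_inv c)"

definition transition :: "('m, 'e) chart \<Rightarrow> ('m, 'e) chart \<Rightarrow> 'e \<Rightarrow> 'e" where
  "transition c d = snd d \<circ> chart_inv c"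

definition smooth_manifold ::
    "('m::{t2_space, second_countable_topology}, 'e::euclidean_space) chart set \<Rightarrow> bool" where
  "smooth_manifold A \<longleftrightarrow>
     (\<forall>c\<in>A. is_chart c) \<and> (\<Union>c\<in>A. fst c) = UNIV \<and>
     (\<forall>c\<in>A. \<forall>d\<in>A. smooth_on (snd c ` (fst c \<inter> fst d)) (transition c d))"

definition smooth_function :: "('m, 'e::euclidean_space) chart set \<Rightarrow> ('m \<Rightarrow> real) \<Rightarrow> bool" where
  "smooth_function A f \<longleftrightarrow> (\<forall>c\<in>A. smooth_on (chart_image c) (f \<circ> chart_inv c))"

text \<open>Forms and vector fields on the manifold are given by their coordinate representations in the
  charts of the atlas; representations in different charts correspond under the transition maps. The
  value of a representation outside the image of its chart is irrelevant.\<close>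

type_synonym ('m, 'e) dform = "('m, 'e) chart \<Rightarrow> 'e \<Rightarrow> 'e mform"
type_synonym ('m, 'e) vfield = "('m, 'e) chart \<Rightarrow> 'e \<Rightarrow> 'e"

definition differential_form ::
    "('m, 'e::euclidean_space) chart set \<Rightarrow> nat \<Rightarrow> ('m, 'e) dform \<Rightarrow> bool" where
  "differential_form A k \<omega> \<longleftrightarrow>
     (\<forall>c\<in>A. \<forall>x\<in>chart_image c. alternating_form k (\<omega> c x)) \<and>
     (\<forall>c\<in>A. \<forall>vs. smooth_on (chart_image c) (\<lambda>x. \<omega> c x vs)) \<and>
     (\<forall>c\<in>A. \<forall>d\<in>A. \<forall>x\<in>snd c ` (fst c \<inter> fst d). \<forall>vs.
        \<omega> c x vs = \<omega> d (transition c d x) (map (frechet_derivative (transition c d) (at x)) vs))"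

definition vector_field :: "('m, 'e::euclidean_space) chart set \<Rightarrow> ('m, 'e) vfield \<Rightarrow> bool" where
  "vector_field A Z \<longleftrightarrow>
     (\<forall>c\<in>A. smooth_on (chart_image c) (Z c)) \<and>
     (\<forall>c\<in>A. \<forall>d\<in>A. \<forall>x\<in>snd c ` (fst c \<inter> fst d).
        Z d (transition c d x) = frechet_derivative (transition c d) (at x) (Z c x))"

definition d_form :: "('m, 'e::euclidean_space) dform \<Rightarrow> ('m, 'e) dform" where
  "d_form \<omega> = (\<lambda>c. ext_deriv (\<omega> c))"

definition wedge_form :: "nat \<Rightarrow> nat \<Rightarrow> ('m, 'e) dform \<Rightarrow> ('m, 'e) dform \<Rightarrow> ('m, 'e) dform" where
  "wedge_form k l \<alpha> \<beta> = (\<lambda>c x. wedge k l (\<alpha> c x) (\<beta> c x))"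

definition power_form :: "('m, 'e) dform \<Rightarrow> nat \<Rightarrow> ('m, 'e) dform" where
  "power_form \<omega> k = (\<lambda>c x. form2_power (\<omega> c x) k)"

text \<open>Equality up to multiplication by a positive smooth function, as a relation on a set
  \<open>S\<close> of forms.\<close>

definition pos_rel ::
    "('m, 'e::euclidean_space) chart set \<Rightarrow> ('m, 'e) dform set \<Rightarrow> (('m, 'e) dform \<times> ('m, 'e) dform) set" where
  "pos_rel A S = {(\<alpha>, \<beta>). \<alpha> \<in> S \<and> \<beta> \<in> S \<and>
     (\<exists>f. smooth_function A f \<and> (\<forall>p. f p > 0) \<and>
        (\<forall>c\<in>A. \<forall>p\<in>fst c. \<forall>vs. \<beta> c (snd c p) vs = f p * \<alpha> c (snd c p) vs))}"


section \<open>Orientations\<close>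

definition volume_forms :: "('m, 'e::euclidean_space) chart set \<Rightarrow> ('m, 'e) dform set" where
  "volume_forms A = {\<mu>. differential_form A DIM('e) \<mu> \<and>
     (\<forall>c\<in>A. \<forall>x\<in>chart_image c. \<mu> c x \<noteq> (\<lambda>_. 0))}"

text \<open>An orientation is identified with the set of its positive volume forms.\<close>

definition orientation ::
    "('m, 'e::euclidean_space) chart set \<Rightarrow> ('m, 'e) dform set \<Rightarrow> bool" where
  "orientation A ori \<longleftrightarrow> ori \<in> volume_forms A // pos_rel A (volume_forms A)"

definition opposite :: "('m, 'e) dform set \<Rightarrow> ('m, 'e) dform set" where
  "opposite ori = (\<lambda>\<mu> c x vs. - \<mu> c x vs) ` ori"

definition induces_orientation_on ::
    "('m, 'e::euclidean_space) chart set \<Rightarrow> ('m, 'e) dform set \<Rightarrow> 'm set \<Rightarrow> ('m, 'e) dform \<Rightarrow> bool" where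
  "induces_orientation_on A ori U \<Omega> \<longleftrightarrow>
     (\<forall>\<mu>\<in>ori. \<forall>c\<in>A. \<forall>p\<in>U \<inter> fst c. \<exists>a>0. \<forall>vs. \<Omega> c (snd c p) vs = a * \<mu> c (snd c p) vs)"


section \<open>Contact Hamiltonian structures\<close>

text \<open>Throughout, the dimension of the manifold is \<open>2 * n\<close>.\<close>

definition contact_Hamiltonian_forms ::
    "('m, 'e::euclidean_space) chart set \<Rightarrow> nat \<Rightarrow> ('m, 'e) dform set" where
  "contact_Hamiltonian_forms A n = {\<alpha>. differential_form A 1 \<alpha> \<and>
     (\<forall>c\<in>A. \<forall>x\<in>chart_image c.
        wedge_form 1 (2 * (n - 1)) \<alpha> (power_form (d_form \<alpha>) (n - 1)) c x = (\<lambda>_. 0) \<longrightarrow>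
        power_form (d_form \<alpha>) n c x \<noteq> (\<lambda>_. 0))}"

definition contact_Hamiltonian_structure ::
    "('m, 'e::euclidean_space) chart set \<Rightarrow> nat \<Rightarrow> ('m, 'e) dform set \<Rightarrow> bool" where
  "contact_Hamiltonian_structure A n \<eta> \<longleftrightarrow>
     \<eta> \<in> contact_Hamiltonian_forms A n // pos_rel A (contact_Hamiltonian_forms A n)"

text \<open>The vector fields spanning the singular line field, for all choices of a form in \<open>\<eta>\<close> and of a
  positive volume form; they differ by multiplication by positive smooth functions.\<close>

definition characteristic_foliation ::
    "('m, 'e::euclidean_space) chart set \<Rightarrow> ('m, 'e) dform set \<Rightarrow> nat \<Rightarrow> ('m, 'e) dform set
      \<Rightarrow> ('m, 'e) vfield set" where
  "characteristic_foliation A ori n \<eta> = {Z. vector_field A Z \<and>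
     (\<exists>\<alpha>\<in>\<eta>. \<exists>\<mu>\<in>ori. \<forall>c\<in>A. \<forall>x\<in>chart_image c.
        interior_mult (Z c x) (\<mu> c x)
          = wedge_form 1 (2 * (n - 1)) \<alpha> (power_form (d_form \<alpha>) (n - 1)) c x)}"

definition integral_curve ::
    "('m::topological_space, 'e::euclidean_space) chart set \<Rightarrow> ('m, 'e) vfield \<Rightarrow> real set \<Rightarrow> (real \<Rightarrow> 'm) \<Rightarrow> bool" where
  "integral_curve A Z I \<gamma> \<longleftrightarrow> open I \<and> is_interval I \<and> continuous_on I \<gamma> \<and>
     (\<forall>t\<in>I. \<forall>c\<in>A. \<gamma> t \<in> fst c \<longrightarrow>
        ((snd c \<circ> \<gamma>) has_vector_derivative Z c (snd c (\<gamma> t))) (at t))"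

text \<open>Rescaling a vector field by a positive function only reparametrizes its integral curves, so it
  does not matter which of the spanning vector fields is used.\<close>

definition invariant_set ::
    "('m::topological_space, 'e::euclidean_space) chart set \<Rightarrow> ('m, 'e) vfield set \<Rightarrow> 'm set \<Rightarrow> bool" where
  "invariant_set A F \<Lambda> \<longleftrightarrow>
     (\<exists>Z\<in>F. \<forall>I \<gamma>. integral_curve A Z I \<gamma> \<and> \<gamma> ` I \<inter> \<Lambda> \<noteq> {} \<longrightarrow> \<gamma> ` I \<subseteq> \<Lambda>)"

definition symplectic_on ::
    "('m, 'e::euclidean_space) chart set \<Rightarrow> 'm set \<Rightarrow> ('m, 'e) dform \<Rightarrow> bool" where
  "symplectic_on A U \<omega> \<longleftrightarrow>
     (\<forall>c\<in>A. \<forall>p\<in>U \<inter> fst c.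
        d_form \<omega> c (snd c p) = (\<lambda>_. 0) \<and>
        (\<forall>v. v \<noteq> 0 \<longrightarrow> (\<exists>w. \<omega> c (snd c p) [v, w] \<noteq> 0)))"

definition Liouville_form_on ::
    "('m, 'e::euclidean_space) chart set \<Rightarrow> 'm set \<Rightarrow> ('m, 'e) dform \<Rightarrow> bool" where
  "Liouville_form_on A U \<alpha> \<longleftrightarrow> symplectic_on A U (d_form \<alpha>)"

definition Liouville_set ::
    "('m::topological_space, 'e::euclidean_space) chart set \<Rightarrow> ('m, 'e) dform set \<Rightarrow> 'm set \<Rightarrow> bool" where
  "Liouville_set A \<eta> \<Lambda> \<longleftrightarrow>
     (\<exists>\<alpha>\<in>\<eta>. \<exists>U. open U \<and> \<Lambda> \<subseteq> U \<and> Liouville_form_on A U \<alpha>)"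

definition positive_set ::
    "('m::topological_space, 'e::euclidean_space) chart set \<Rightarrow> ('m, 'e) dform set \<Rightarrow> nat
      \<Rightarrow> ('m, 'e) dform set \<Rightarrow> 'm set \<Rightarrow> bool" where
  "positive_set A ori n \<eta> \<Lambda> \<longleftrightarrow>
     (\<exists>\<alpha>\<in>\<eta>. \<exists>U. open U \<and> \<Lambda> \<subseteq> U \<and> Liouville_form_on A U \<alpha> \<and>
        induces_orientation_on A ori U (power_form (d_form \<alpha>) n))"

definition negative_set ::
    "('m::topological_space, 'e::euclidean_space) chart set \<Rightarrow> ('m, 'e) dform set \<Rightarrow> nat
      \<Rightarrow> ('m, 'e) dform set \<Rightarrow> 'm set \<Rightarrow> bool" where
  "negative_set A ori n \<eta> \<Lambda> \<longleftrightarrow> positive_set A (opposite ori) n \<eta> \<Lambda>"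

end

theory Submission
  imports Defs
begin

text \<open>
  All forms in \<open>\<eta>\<close> are positive multiples of one representative \<open>\<alpha>\<^sub>0\<close>, and by the Leibniz rule
  \<open>(d(f \<alpha>\<^sub>0))\<^sup>n = f\<^sup>n (d\<alpha>\<^sub>0)\<^sup>n + n f\<^sup>n\<^sup>-\<^sup>1 df \<and> \<alpha>\<^sub>0 \<and> (d\<alpha>\<^sub>0)\<^sup>n\<^sup>-\<^sup>1\<close>
  (lemma \<open>rescaled_contact_form_powers\<close>). Suppose that \<open>f\<^sub>1 \<alpha>\<^sub>0\<close> makes \<open>\<Lambda>\<close> positive and \<open>f\<^sub>2 \<alpha>\<^sub>0\<close> makes it
  negative. Eliminating \<open>(d\<alpha>\<^sub>0)\<^sup>n\<close> from the two formulas gives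
  \<open>f\<^sub>2\<^sup>n (d(f\<^sub>1 \<alpha>\<^sub>0))\<^sup>n - f\<^sub>1\<^sup>n (d(f\<^sub>2 \<alpha>\<^sub>0))\<^sup>n =
    n (f\<^sub>1 f\<^sub>2)\<^sup>n\<^sup>-\<^sup>1 (f\<^sub>2 df\<^sub>1 - f\<^sub>1 df\<^sub>2) \<and> \<alpha>\<^sub>0 \<and> (d\<alpha>\<^sub>0)\<^sup>n\<^sup>-\<^sup>1\<close>.
  At every point of \<open>\<Lambda>\<close> the left-hand side is a positive volume form.

  The right-hand side has a zero on \<open>\<Lambda>\<close>. By compactness \<open>f\<^sub>1 / f\<^sub>2\<close> attains its minimum on \<open>\<Lambda>\<close> at some
  point \<open>p\<close>. The integral curve of the characteristic vector field \<open>Z\<close> through \<open>p\<close> stays in \<open>\<Lambda>\<close>, so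
  \<open>f\<^sub>1 / f\<^sub>2\<close> is critical along it: the covector \<open>b = f\<^sub>2 df\<^sub>1 - f\<^sub>1 df\<^sub>2\<close> kills \<open>Z\<close> at \<open>p\<close>
  (lemma \<open>derivative_zero_at_minimum_on_invariant_set\<close>). The form \<open>\<alpha>\<^sub>0 \<and> (d\<alpha>\<^sub>0)\<^sup>n\<^sup>-\<^sup>1\<close> is a multiple of
  \<open>\<iota>\<^sub>Z\<mu>\<close>, and \<open>b \<and> \<iota>\<^sub>Z\<mu> = b(Z) \<mu>\<close> in top degree, so the right-hand side is zero at \<open>p\<close>
  (lemma \<open>alternation_covector_characteristic_vanishes\<close>).

  Wedge products are handled as alternations of tensor products: an iterated wedge product is the
  alternation of the tensor product of all its factors, so associativity and sign rules reduce to
  permuting arguments. The integral curve comes from the Picard-Lindeloef theorem, proved by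
  Banach's fixed point theorem.
\<close>

section \<open>Alternation of tensor products\<close>

definition tensor :: "nat \<Rightarrow> 'e mform \<Rightarrow> 'e mform \<Rightarrow> 'e mform" where
  "tensor k \<alpha> \<beta> = (\<lambda>vs. \<alpha> (take k vs) * \<beta> (drop k vs))"

text \<open>A plain signed sum, without the usual factor \<open>1 / m!\<close>: the power \<open>\<omega>\<^sup>k\<close> is then
  the alternation of \<open>\<omega> \<otimes> \<dots> \<otimes> \<omega>\<close> up to the factor \<open>1 / 2\<^sup>k\<close>.\<close>

definition alternation :: "nat \<Rightarrow> 'e mform \<Rightarrow> 'e mform" where
  "alternation m T = (\<lambda>vs. if length vs = m
     then \<Sum>\<sigma> | \<sigma> permutes {..<m}. of_int (sign \<sigma>) * T (permute_list \<sigma> vs) else 0)"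

lemma tensor_scale_right: "tensor k \<alpha> (\<lambda>vs. r * \<beta> vs) = (\<lambda>vs. r * tensor k \<alpha> \<beta> vs)"
  by (simp add: tensor_def fun_eq_iff mult_ac)

lemma tensor_lincomb_left:
  "tensor k (\<lambda>vs. r * \<alpha> vs + s * \<beta> vs) \<gamma> = (\<lambda>vs. r * tensor k \<alpha> \<gamma> vs + s * tensor k \<beta> \<gamma> vs)"
  by (simp add: tensor_def fun_eq_iff algebra_simps)

lemma wedge_eq_alternation:
  "wedge k l \<alpha> \<beta> = (\<lambda>vs. alternation (k + l) (tensor k \<alpha> \<beta>) vs / (fact k * fact l))"
  by (auto simp: wedge_def alternation_def tensor_def fun_eq_iff mult.assoc)

lemma alternation_cong:
  assumes "\<And>vs. length vs = m \<Longrightarrow> T vs = T' vs"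
  shows "alternation m T = alternation m T'"
  using assms by (auto simp: alternation_def fun_eq_iff intro!: sum.cong)

lemma alternation_lincomb:
  "alternation m (\<lambda>vs. r * S vs + s * T vs) = (\<lambda>vs. r * alternation m S vs + s * alternation m T vs)"
  by (auto simp: alternation_def fun_eq_iff sum.distrib sum_distrib_left algebra_simps)

lemma alternation_scale: "alternation m (\<lambda>vs. r * S vs) = (\<lambda>vs. r * alternation m S vs)"
  by (auto simp: alternation_def fun_eq_iff sum_distrib_left algebra_simps)

lemma alternation_permute:
  assumes \<tau>: "\<tau> permutes {..<m}"
    and T': "\<And>vs. length vs = m \<Longrightarrow> T' vs = T (permute_list \<tau> vs)"
  shows "alternation m T' = (\<lambda>vs. of_int (sign \<tau>) * alternation m T vs)"
proof
  fix vs :: "'a list"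
  show "alternation m T' vs = of_int (sign \<tau>) * alternation m T vs"
  proof (cases "length vs = m")
    case True
    have "alternation m T vs = (\<Sum>\<sigma> | \<sigma> permutes {..<m}. of_int (sign \<sigma>) * T (permute_list \<sigma> vs))"
      using True by (simp add: alternation_def)
    also have "\<dots> = (\<Sum>\<sigma> | \<sigma> permutes {..<m}.
        of_int (sign (\<sigma> \<circ> \<tau>)) * T (permute_list (\<sigma> \<circ> \<tau>) vs))"
      by (rule sum_permutations_compose_right[OF \<tau>])
    also have "\<dots> = (\<Sum>\<sigma> | \<sigma> permutes {..<m}.
        of_int (sign \<tau>) * (of_int (sign \<sigma>) * T' (permute_list \<sigma> vs)))"
    proof (rule sum.cong)
      fix \<sigma> assume "\<sigma> \<in> {\<sigma>. \<sigma> permutes {..<m}}"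
      then have "sign (\<sigma> \<circ> \<tau>) = sign \<sigma> * sign \<tau>"
        using \<tau> by (intro sign_compose) (auto intro: permutes_imp_permutation)
      moreover have "permute_list (\<sigma> \<circ> \<tau>) vs = permute_list \<tau> (permute_list \<sigma> vs)"
        using \<tau> True by (simp add: permute_list_compose)
      ultimately show "of_int (sign (\<sigma> \<circ> \<tau>)) * T (permute_list (\<sigma> \<circ> \<tau>) vs) =
          of_int (sign \<tau>) * (of_int (sign \<sigma>) * T' (permute_list \<sigma> vs))"
        using True by (simp add: T' mult_ac)
    qed simp
    also have "\<dots> = of_int (sign \<tau>) * alternation m T' vs"
      using True by (simp add: alternation_def sum_distrib_left)
    finally show ?thesis
      by (simp add: sign_def)
  qed (simp add: alternation_def)
qed

lemma alternation_swap:
  assumes "i < m" "j < m" "i \<noteq> j"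
    and T': "\<And>vs. length vs = m \<Longrightarrow> T' vs = T (vs[i := vs ! j, j := vs ! i])"
  shows "alternation m T' = (\<lambda>vs. - alternation m T vs)"
proof -
  have perm: "permute_list (Transposition.transpose i j) vs = vs[i := vs ! j, j := vs ! i]" if "length vs = m" for vs :: "'a list"
    using assms(1-3) that
    by (auto simp: list_eq_iff_nth_eq permute_list_def nth_list_update Transposition.transpose_def)
  show ?thesis
    using alternation_permute[of "Transposition.transpose i j" m T' T] assms perm
    by (simp add: permutes_swap_id sign_swap_id)
qed

text \<open>This is what makes the wedge product associative. Expanding the inner alternation gives one
  summand for each permutation \<open>\<tau>\<close> of the last \<open>l\<close> arguments. Moved to the positions \<open>k, \<dots>, k + l - 1\<close>,
  \<open>\<tau>\<close> is absorbed by the outer alternation at the price of the sign of \<open>\<tau>\<close>, which cancels the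
  sign already present; the \<open>l!\<close> summands are therefore all equal.\<close>

lemma alternation_tensor_alternation:
  "alternation (k + l) (tensor k \<alpha> (alternation l \<beta>)) =
     (\<lambda>vs. fact l * alternation (k + l) (tensor k \<alpha> \<beta>) vs)"
proof
  fix vs :: "'a list"
  let ?P = "{\<tau>. \<tau> permutes {..<l}}"
  let ?shift = "map_permutation {..<l} ((+) k)"
  define T where "T \<tau> vs = \<alpha> (take k vs) * \<beta> (permute_list \<tau> (drop k vs))" for \<tau> vs
  have alt_T: "alternation (k + l) (T \<tau>) =
      (\<lambda>vs. of_int (sign \<tau>) * alternation (k + l) (tensor k \<alpha> \<beta>) vs)"
    if \<tau>: "\<tau> permutes {..<l}" for \<tau>
  proof -
    have inj: "inj_on ((+) k) {..<l}" by simp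
    have "?shift \<tau> permutes {k..<k + l}"
      by (rule map_permutation_permutes[OF _ \<tau>])
        (auto simp: bij_betw_def lessThan_atLeast0)
    then have shift: "?shift \<tau> permutes {..<k + l}"
      by (rule permutes_subset) auto
    have apply_shift: "?shift \<tau> i = (if i < k then i else k + \<tau> (i - k))" if "i < k + l" for i
    proof (cases "i < k")
      case True
      then show ?thesis
        using \<open>?shift \<tau> permutes {k..<k + l}\<close> by (simp add: permutes_not_in)
    next
      case False
      then show ?thesis
        using map_permutation_apply[OF inj, of "i - k" \<tau>] that by simp
    qed
    have "T \<tau> vs = tensor k \<alpha> \<beta> (permute_list (?shift \<tau>) vs)" if "length vs = k + l" for vs
    proof -
      have \<tau>l: "\<tau> i < l" if "i < l" for i
        using permutes_in_image[OF \<tau>, of i] that by simp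
      have "take k (permute_list (?shift \<tau>) vs) = take k vs"
        "drop k (permute_list (?shift \<tau>) vs) = permute_list \<tau> (drop k vs)"
        using that by (auto simp: list_eq_iff_nth_eq permute_list_def apply_shift \<tau>l)
      then show ?thesis
        by (simp add: T_def tensor_def)
    qed
    from alternation_permute[where T = "tensor k \<alpha> \<beta>", OF shift this] show ?thesis
      by (simp add: sign_map_permutation[OF inj \<tau>])
  qed
  have tensor_T: "tensor k \<alpha> (alternation l \<beta>) us = (\<Sum>\<tau>\<in>?P. of_int (sign \<tau>) * T \<tau> us)"
    if "length us = k + l" for us
    using that by (simp add: tensor_def alternation_def T_def sum_distrib_left mult_ac)
  show "alternation (k + l) (tensor k \<alpha> (alternation l \<beta>)) vs =
     fact l * alternation (k + l) (tensor k \<alpha> \<beta>) vs"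
  proof (cases "length vs = k + l")
    case True
    have "alternation (k + l) (tensor k \<alpha> (alternation l \<beta>)) vs =
        (\<Sum>\<sigma> | \<sigma> permutes {..<k+l}. \<Sum>\<tau>\<in>?P.
           of_int (sign \<tau>) * (of_int (sign \<sigma>) * T \<tau> (permute_list \<sigma> vs)))"
      using True by (simp add: alternation_def[of "k + l"] tensor_T sum_distrib_left mult_ac)
    also have "\<dots> = (\<Sum>\<tau>\<in>?P. of_int (sign \<tau>) * alternation (k + l) (T \<tau>) vs)"
      using True by (subst sum.swap) (simp add: alternation_def sum_distrib_left)
    also have "\<dots> = (\<Sum>\<tau>\<in>?P. alternation (k + l) (tensor k \<alpha> \<beta>) vs)"
      by (rule sum.cong) (auto simp: alt_T sign_def)
    also have "\<dots> = fact l * alternation (k + l) (tensor k \<alpha> \<beta>) vs"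
      by (simp add: card_permutations[of "{..<l}" l])
    finally show ?thesis .
  qed (simp add: alternation_def)
qed

text \<open>A tensor factor may be replaced by any other one with the same alternation. This allows
  computations inside a longer product.\<close>

lemma alternation_tensor_cong:
  assumes "alternation l \<beta> = alternation l \<beta>'"
  shows "alternation (k + l) (tensor k \<alpha> \<beta>) = alternation (k + l) (tensor k \<alpha> \<beta>')"
proof
  fix vs
  have "fact l * alternation (k + l) (tensor k \<alpha> \<beta>) vs = fact l * alternation (k + l) (tensor k \<alpha> \<beta>') vs"
    using assms by (metis alternation_tensor_alternation)
  then show "alternation (k + l) (tensor k \<alpha> \<beta>) vs = alternation (k + l) (tensor k \<alpha> \<beta>') vs"
    by simp
qed

primrec tensor_power :: "'e mform \<Rightarrow> nat \<Rightarrow> 'e mform" where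
  "tensor_power \<omega> 0 = (\<lambda>_. 1)"
| "tensor_power \<omega> (Suc k) = tensor 2 \<omega> (tensor_power \<omega> k)"

text \<open>Each multiplication by \<open>\<omega>\<close> contributes the factor \<open>1 / (2! (2k)!)\<close> of the wedge product, of
  which \<open>(2k)!\<close> cancels against the alternation already contained in \<open>\<omega>\<^sup>k\<close>.\<close>

lemma form2_power_eq_alternation:
  "form2_power \<omega> k = (\<lambda>vs. (1/2) ^ k * alternation (2 * k) (tensor_power \<omega> k) vs)"
proof (induction k)
  case 0
  have "{\<sigma>. \<sigma> permutes {..<0::nat}} = {id}"
    by auto
  then show ?case
    by (auto simp: alternation_def fun_eq_iff simp del: permutes_empty lessThan_0)
next
  case (Suc k)
  have "wedge 2 (2 * k) \<omega> (form2_power \<omega> k) =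
      (\<lambda>vs. (1/2) ^ Suc k * alternation (2 + 2 * k) (tensor 2 \<omega> (tensor_power \<omega> k)) vs)"
    by (simp only: Suc.IH wedge_eq_alternation tensor_scale_right alternation_scale
        alternation_tensor_alternation) simp
  then show ?case by simp
qed

lemma wedge_form2_power_eq_alternation:
  "wedge 1 (2 * k) a (form2_power \<omega> k) =
     (\<lambda>vs. (1/2) ^ k * alternation (1 + 2 * k) (tensor 1 a (tensor_power \<omega> k)) vs)"
  by (simp only: form2_power_eq_alternation wedge_eq_alternation tensor_scale_right alternation_scale
        alternation_tensor_alternation) simp

lemma length_Suc2E:
  assumes "length vs = Suc (Suc l)"
  obtains x y zs where "vs = x # y # zs" "length zs = l"
  using assms by (auto simp: length_Suc_conv)

lemma length_Suc3E:
  assumes "length vs = Suc (Suc (Suc l))"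
  obtains x y z zs where "vs = x # y # z # zs" "length zs = l"
  using assms by (auto simp: length_Suc_conv)

lemma alternation_covectors_swap:
  "alternation (Suc (Suc l)) (tensor 1 a (tensor 1 b R)) =
     (\<lambda>vs. - alternation (Suc (Suc l)) (tensor 1 b (tensor 1 a R)) vs)"
  by (rule alternation_swap[of 0 _ 1]) (auto simp: tensor_def elim!: length_Suc2E)

lemma alternation_covector_square:
  "alternation (Suc (Suc l)) (tensor 1 a (tensor 1 a R)) = (\<lambda>_. 0)"
  using alternation_covectors_swap[of l a a R] by (simp add: fun_eq_iff)

text \<open>A 2-form commutes with a covector, since moving one argument past two others is a product of
  two transpositions. The intermediate tensor \<open>T\<close> in the proof is the result of the first one.\<close>

lemma alternation_form2_covector:
  "alternation (Suc (Suc (Suc l))) (tensor 2 \<omega> (tensor 1 b R)) = alternation (Suc (Suc (Suc l))) (tensor 1 b (tensor 2 \<omega> R))"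
proof -
  define T where "T vs = \<omega> [vs ! 0, vs ! 2] * b [vs ! 1] * R (drop 3 vs)" for vs
  have "alternation (Suc (Suc (Suc l))) (tensor 2 \<omega> (tensor 1 b R)) = (\<lambda>vs. - alternation (Suc (Suc (Suc l))) T vs)"
    by (rule alternation_swap[of 1 _ 2])
      (auto simp: tensor_def T_def numeral_2_eq_2 numeral_3_eq_3 elim!: length_Suc3E)
  moreover have "alternation (Suc (Suc (Suc l))) T = (\<lambda>vs. - alternation (Suc (Suc (Suc l))) (tensor 1 b (tensor 2 \<omega> R)) vs)"
    by (rule alternation_swap[of 0 _ 1])
      (auto simp: tensor_def T_def numeral_2_eq_2 numeral_3_eq_3 elim!: length_Suc3E)
  ultimately show ?thesis by simp
qed

text \<open>In the notation of wedge products: if \<open>\<omega>' = f \<omega> + b \<and> a\<close>, then \<open>a \<and> \<omega>'\<^sup>k = f\<^sup>k a \<and> \<omega>\<^sup>k\<close>,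
  because \<open>a \<and> b \<and> a = 0\<close>.\<close>

lemma alternation_covector_tensor_power:
  assumes \<omega>': "\<And>u v. \<omega>' [u, v] = f * \<omega> [u, v] + (b [u] * a [v] - a [u] * b [v])"
  shows "alternation (1 + 2 * k) (tensor 1 a (tensor_power \<omega>' k)) =
    (\<lambda>vs. f ^ k * alternation (1 + 2 * k) (tensor 1 a (tensor_power \<omega> k)) vs)"
proof (induction k)
  case 0
  then show ?case by simp
next
  case (Suc k)
  let ?m = "1 + 2 * Suc k"
  let ?R' = "tensor_power \<omega>' k" and ?R = "tensor_power \<omega> k"
  \<comment> \<open>The summands are nested and carry the factors \<open>1\<close> and \<open>-1\<close> to match \<open>alternation_lincomb\<close>.\<close>
  have "alternation ?m (tensor 1 a (tensor 2 \<omega>' ?R')) =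
      alternation ?m (\<lambda>vs. f * tensor 1 a (tensor 2 \<omega> ?R') vs +
        1 * (1 * tensor 1 a (tensor 1 b (tensor 1 a ?R')) vs + (-1) * tensor 1 a (tensor 1 a (tensor 1 b ?R')) vs))"
    by (rule alternation_cong)
      (auto simp: tensor_def numeral_2_eq_2 algebra_simps \<omega>' elim!: length_Suc3E)
  also have "\<dots> = (\<lambda>vs. f * alternation ?m (tensor 1 a (tensor 2 \<omega> ?R')) vs)"
  proof -
    have 1: "alternation ?m (tensor 1 a (tensor 1 a (tensor 1 b ?R'))) = (\<lambda>_. 0)"
      using alternation_covector_square[of "1 + 2 * k" a] by simp
    have "alternation ?m (tensor 1 a (tensor 1 b (tensor 1 a ?R'))) =
        (\<lambda>vs. - alternation ?m (tensor 1 b (tensor 1 a (tensor 1 a ?R'))) vs)"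
      using alternation_covectors_swap[of "1 + 2 * k" a b] by simp
    moreover have "alternation (1 + Suc (Suc (2 * k))) (tensor 1 b (tensor 1 a (tensor 1 a ?R'))) =
        alternation (1 + Suc (Suc (2 * k))) (tensor 1 b (\<lambda>_. 0))"
      by (rule alternation_tensor_cong) (simp only: alternation_covector_square, simp add: alternation_def fun_eq_iff)
    moreover have "alternation (1 + Suc (Suc (2 * k))) (tensor 1 b (\<lambda>_. 0)) = (\<lambda>_. 0)"
      by (simp add: alternation_def tensor_def fun_eq_iff)
    ultimately have 2: "alternation ?m (tensor 1 a (tensor 1 b (tensor 1 a ?R'))) = (\<lambda>_. 0)"
      by simp
    show ?thesis
      unfolding alternation_lincomb 1 2 by simp
  qed
  also have "alternation ?m (tensor 1 a (tensor 2 \<omega> ?R')) = alternation ?m (tensor 2 \<omega> (tensor 1 a ?R'))"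
    using alternation_form2_covector[of "2 * k" \<omega> a] by simp
  also have "alternation (2 + (1 + 2 * k)) (tensor 2 \<omega> (tensor 1 a ?R')) =
      alternation (2 + (1 + 2 * k)) (tensor 2 \<omega> (\<lambda>vs. f ^ k * tensor 1 a ?R vs))"
    by (rule alternation_tensor_cong) (simp only: Suc.IH alternation_scale)
  then have "alternation ?m (tensor 2 \<omega> (tensor 1 a ?R')) =
      (\<lambda>vs. f ^ k * alternation ?m (tensor 2 \<omega> (tensor 1 a ?R)) vs)"
    by (simp add: tensor_scale_right alternation_scale)
  also have "alternation ?m (tensor 2 \<omega> (tensor 1 a ?R)) = alternation ?m (tensor 1 a (tensor 2 \<omega> ?R))"
    using alternation_form2_covector[of "2 * k" \<omega> a] by simp
  finally show ?case by (simp add: mult.assoc)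
qed

text \<open>In the notation of wedge products: if \<open>\<omega>' = f \<omega> + b \<and> a\<close>, then
  \<open>\<omega>'\<^sup>k\<^sup>+\<^sup>1 = f\<^sup>k\<^sup>+\<^sup>1 \<omega>\<^sup>k\<^sup>+\<^sup>1 + (k + 1) f\<^sup>k b \<and> a \<and> \<omega>\<^sup>k\<close>. One factor is split off at a time,
  \<open>\<omega>'\<^sup>k\<^sup>+\<^sup>1 = f \<omega> \<and> \<omega>'\<^sup>k + b \<and> a \<and> \<omega>'\<^sup>k\<close>; the second summand is \<open>f\<^sup>k b \<and> a \<and> \<omega>\<^sup>k\<close> by the
  previous lemma, and the first one is covered by induction after \<open>\<omega>\<close> is moved past \<open>b\<close> and \<open>a\<close>.
  The additional factor \<open>2\<close> in the statement comes from \<open>b \<and> a\<close>, whose two terms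
  have the same alternation up to sign.\<close>

lemma alternation_tensor_power_perturb:
  assumes \<omega>': "\<And>u v. \<omega>' [u, v] = f * \<omega> [u, v] + (b [u] * a [v] - a [u] * b [v])"
  shows "alternation (2 * Suc k) (tensor_power \<omega>' (Suc k)) =
    (\<lambda>vs. f ^ Suc k * alternation (2 * Suc k) (tensor_power \<omega> (Suc k)) vs +
       2 * real (Suc k) * f ^ k * alternation (2 * Suc k) (tensor 1 b (tensor 1 a (tensor_power \<omega> k))) vs)"
proof -
  have step: "alternation (2 * Suc k) (tensor_power \<omega>' (Suc k)) =
     (\<lambda>vs. f * alternation (2 * Suc k) (tensor 2 \<omega> (tensor_power \<omega>' k)) vs +
       2 * f ^ k * alternation (2 * Suc k) (tensor 1 b (tensor 1 a (tensor_power \<omega> k))) vs)" for k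
  proof -
    let ?m = "2 * Suc k"
    let ?R' = "tensor_power \<omega>' k" and ?R = "tensor_power \<omega> k"
    \<comment> \<open>The summands are nested and carry the factors \<open>1\<close> and \<open>-1\<close> to match \<open>alternation_lincomb\<close>.\<close>
    have "alternation ?m (tensor 2 \<omega>' ?R') =
        alternation ?m (\<lambda>vs. f * tensor 2 \<omega> ?R' vs +
          1 * (1 * tensor 1 b (tensor 1 a ?R') vs + (-1) * tensor 1 a (tensor 1 b ?R') vs))"
      by (rule alternation_cong)
        (auto simp: tensor_def numeral_2_eq_2 algebra_simps \<omega>' elim!: length_Suc2E)
    also have "\<dots> = (\<lambda>vs. f * alternation ?m (tensor 2 \<omega> ?R') vs +
       2 * alternation ?m (tensor 1 b (tensor 1 a ?R')) vs)"
      unfolding alternation_lincomb using alternation_covectors_swap[of "2 * k" a b] by simp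
    also have "alternation ?m (tensor 1 b (tensor 1 a ?R')) =
        (\<lambda>vs. f ^ k * alternation ?m (tensor 1 b (tensor 1 a ?R)) vs)"
      using alternation_tensor_cong[of "1 + 2 * k" "tensor 1 a ?R'" "\<lambda>vs. f ^ k * tensor 1 a ?R vs" 1 b]
        alternation_covector_tensor_power[of \<omega>' f \<omega> b a k, OF \<omega>']
      by (simp add: alternation_scale tensor_scale_right)
    finally show ?thesis by (simp add: mult_ac)
  qed
  show ?thesis
  proof (induction k)
    case 0
    show ?case unfolding step by (simp add: fun_eq_iff)
  next
    case (Suc k)
    let ?X = "\<lambda>k. tensor 1 b (tensor 1 a (tensor_power \<omega> k))"
    have "alternation (2 + 2 * Suc k) (tensor 2 \<omega> (tensor_power \<omega>' (Suc k))) =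
        alternation (2 + 2 * Suc k) (tensor 2 \<omega> (\<lambda>vs. f ^ Suc k * tensor_power \<omega> (Suc k) vs +
          (2 * real (Suc k) * f ^ k) * ?X k vs))"
      by (rule alternation_tensor_cong) (simp only: Suc.IH alternation_lincomb)
    also have "tensor 2 \<omega> (\<lambda>vs. f ^ Suc k * tensor_power \<omega> (Suc k) vs + (2 * real (Suc k) * f ^ k) * ?X k vs) =
        (\<lambda>vs. f ^ Suc k * tensor_power \<omega> (Suc (Suc k)) vs + (2 * real (Suc k) * f ^ k) * tensor 2 \<omega> (?X k) vs)"
      by (simp add: tensor_def fun_eq_iff algebra_simps)
    also have "alternation (2 + 2 * Suc k) \<dots> =
      (\<lambda>vs. f ^ Suc k * alternation (2 + 2 * Suc k) (tensor_power \<omega> (Suc (Suc k))) vs +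
        (2 * real (Suc k) * f ^ k) * alternation (2 + 2 * Suc k) (tensor 2 \<omega> (?X k)) vs)"
      by (rule alternation_lincomb)
    also have "alternation (2 + 2 * Suc k) (tensor 2 \<omega> (?X k)) =
       alternation (Suc (Suc (Suc (1 + 2 * k)))) (tensor 1 b (tensor 2 \<omega> (tensor 1 a (tensor_power \<omega> k))))"
      using alternation_form2_covector[of "1 + 2 * k" \<omega> b "tensor 1 a (tensor_power \<omega> k)"] by simp
    also have "\<dots> = alternation (1 + Suc (Suc (Suc (2 * k)))) (tensor 1 b (tensor 1 a (tensor 2 \<omega> (tensor_power \<omega> k))))"
      using alternation_tensor_cong[OF alternation_form2_covector[of "2 * k" \<omega> a "tensor_power \<omega> k"], of 1 b] by simp
    finally have *: "alternation (2 * Suc (Suc k)) (tensor 2 \<omega> (tensor_power \<omega>' (Suc k))) =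
      (\<lambda>vs. f ^ Suc k * alternation (2 * Suc (Suc k)) (tensor_power \<omega> (Suc (Suc k))) vs +
        (2 * real (Suc k) * f ^ k) * alternation (2 * Suc (Suc k)) (?X (Suc k)) vs)"
      by simp
    show ?case
      unfolding step[of "Suc k"] * by (simp add: fun_eq_iff algebra_simps del: tensor_power.simps)
  qed
qed

section \<open>Covectors and interior products in top degree\<close>

text \<open>If \<open>\<mu>\<close> does not vanish on \<open>ws\<close>, then \<open>ws\<close> is a basis and \<open>u \<mapsto> (\<mu>(ws[i := u]))\<^sub>i\<close> is, up to the factor
  \<open>\<mu> ws\<close>, its coordinate map. This map is injective, so some entry of \<open>ws\<close> can be exchanged for \<open>v\<close>.\<close>

lemma top_form_nonzero_with_entry:
  fixes \<mu> :: "'e::euclidean_space mform"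
  assumes alt: "alternating_form DIM('e) \<mu>" and ws: "\<mu> ws \<noteq> 0" and v: "v \<noteq> 0"
  obtains i where "i < DIM('e)" "\<mu> (ws[i := v]) \<noteq> 0"
proof -
  have len: "length ws = DIM('e)"
    using alt ws by (auto simp: alternating_form_def)
  have lin: "linear (\<lambda>u. \<mu> (ws[i := u]))" if "i < DIM('e)" for i
    using alt len that by (auto simp: alternating_form_def)
  have repeat: "\<mu> (ws[i := ws ! j]) = 0" if "i \<noteq> j" "i < DIM('e)" "j < DIM('e)" for i j
  proof -
    have "(ws[i := ws ! j]) ! (min i j) = (ws[i := ws ! j]) ! (max i j)"
      using that len by (auto simp: min_def max_def)
    moreover have "min i j < max i j" "max i j < DIM('e)"
      using that by auto
    ultimately show ?thesis
      using alt len unfolding alternating_form_def by (metis length_list_update)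
  qed
  obtain es :: "'e list" where es: "set es = Basis" "distinct es"
    using finite_distinct_list[of "Basis :: 'e set"] by auto
  then have len_es: "length es = DIM('e)"
    using distinct_card by fastforce
  \<comment> \<open>Basis vectors stand in for the indices of coordinates, so that \<open>L\<close> is an endomorphism and
    surjectivity implies injectivity.\<close>
  define L where "L u = (\<Sum>i<DIM('e). \<mu> (ws[i := u]) *\<^sub>R es ! i)" for u
  have linL: "linear L"
    unfolding L_def
    by (intro linear_compose_sum ballI)
      (auto intro!: linearI simp: linear_add[OF lin] linear_scale[OF lin] scaleR_left_distrib)
  have L_ws: "L (ws ! j) = \<mu> ws *\<^sub>R es ! j" if "j < DIM('e)" for j
  proof -
    have "L (ws ! j) = (\<Sum>i<DIM('e). if i = j then \<mu> ws *\<^sub>R es ! j else 0)"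
      unfolding L_def by (rule sum.cong) (use that repeat in auto)
    then show ?thesis using that by simp
  qed
  have "Basis \<subseteq> range L"
  proof
    fix e :: 'e assume "e \<in> Basis"
    then obtain j where j: "j < DIM('e)" "e = es ! j"
      using es len_es by (metis in_set_conv_nth)
    have "L ((1 / \<mu> ws) *\<^sub>R ws ! j) = e"
      using ws by (simp add: linear_scale[OF linL] L_ws j)
    then show "e \<in> range L" by (metis rangeI)
  qed
  then have "span Basis \<subseteq> range L"
    by (intro span_minimal linear_subspace_image linL subspace_UNIV)
  then have "surj L" by auto
  then have "inj L"
    by (rule linear_surjective_imp_injective[OF linL _ refl])
  then have "L v \<noteq> 0"
    using v linear_injective_0[OF linL] by auto
  then have "\<exists>i\<in>{..<DIM('e)}. \<mu> (ws[i := v]) *\<^sub>R es ! i \<noteq> 0"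
    unfolding L_def by (meson sum.neutral)
  then show ?thesis using that by auto
qed

text \<open>The identity \<open>b \<and> \<iota>\<^sub>v\<mu> = b(v) \<mu>\<close> for \<open>b(v) = 0\<close>, on a list of arguments containing \<open>v\<close>. Every term
  of the alternation vanishes by itself: \<open>v\<close> is either the argument of \<open>b\<close> or appears twice in \<open>\<mu>\<close>.\<close>

lemma covector_wedge_interior_mult_vanishes:
  fixes \<mu> :: "'e::euclidean_space mform"
  assumes alt: "alternating_form m \<mu>" and len: "length vs = m" and i: "i < m" and b: "b (vs ! i) = 0"
  shows "alternation m (tensor 1 (\<lambda>ws. b (hd ws)) (interior_mult (vs ! i) \<mu>)) vs = 0"
proof -
  have "tensor 1 (\<lambda>ws. b (hd ws)) (interior_mult (vs ! i) \<mu>) (permute_list \<sigma> vs) = 0"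
    if \<sigma>: "\<sigma> permutes {..<m}" for \<sigma>
  proof -
    let ?us = "permute_list \<sigma> vs"
    have "?us \<noteq> []"
      using len i by (metis length_permute_list list.size(3) not_less_zero)
    then have hd: "hd (take 1 ?us) = ?us ! 0"
      by (simp add: hd_conv_nth)
    obtain j where j: "\<sigma> j = i" "j < m"
      using \<sigma> i by (metis lessThan_iff permutes_def permutes_in_image)
    then have us_j: "?us ! j = vs ! i"
      using len \<sigma> by (simp add: permute_list_nth)
    show ?thesis
    proof (cases "j = 0")
      case True
      then show ?thesis using us_j b hd by (simp add: tensor_def)
    next
      case False
      let ?l = "vs ! i # drop 1 ?us"
      have "length ?l = m" "?l ! 0 = ?l ! j" "0 < j"
        using False j us_j len by auto
      then have "\<mu> ?l = 0"
        using alt j(2) unfolding alternating_form_def by blast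
      then show ?thesis by (simp add: tensor_def interior_mult_def)
    qed
  qed
  then show ?thesis by (simp add: alternation_def)
qed

text \<open>The tensor product of \<open>b\<close> and \<open>T\<close> has, up to a nonzero factor, the same alternation as that of \<open>b\<close> and
  \<open>\<iota>\<^sub>v\<mu>\<close>. If \<open>v = 0\<close>, the latter vanishes identically; otherwise it vanishes on every list containing
  \<open>v\<close>, and \<open>\<mu>\<close> is nonzero on one of these.\<close>

lemma alternation_covector_characteristic_vanishes:
  fixes \<mu> :: "'e::euclidean_space mform"
  assumes alt: "alternating_form DIM('e) \<mu>" and "\<mu> \<noteq> (\<lambda>_. 0)" and b: "b v = 0"
    and v: "interior_mult v \<mu> = (\<lambda>vs. r * alternation m T vs)" and "r \<noteq> 0" and m: "DIM('e) = 1 + m"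
  obtains vs where "\<mu> vs \<noteq> 0" "alternation DIM('e) (tensor 1 (\<lambda>ws. b (hd ws)) T) vs = 0"
proof -
  have *: "alternation DIM('e) (tensor 1 (\<lambda>ws. b (hd ws)) T) vs = 0"
    if "alternation DIM('e) (tensor 1 (\<lambda>ws. b (hd ws)) (interior_mult v \<mu>)) vs = 0" for vs
    using that \<open>r \<noteq> 0\<close>
    unfolding v m by (simp only: tensor_scale_right alternation_scale alternation_tensor_alternation) simp
  obtain ws where ws: "\<mu> ws \<noteq> 0" using \<open>\<mu> \<noteq> (\<lambda>_. 0)\<close> by auto
  then have len: "length ws = DIM('e)" using alt by (auto simp: alternating_form_def)
  show ?thesis
  proof (cases "v = 0")
    case True
    have "interior_mult v \<mu> us = 0" for us
    proof (cases "length (v # us) = DIM('e)")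
      case len: True
      then have "linear (\<lambda>u. \<mu> ((v # us)[0 := u]))"
        using alt unfolding alternating_form_def by (metis DIM_positive)
      then show ?thesis
        using linear_0 True by (fastforce simp: interior_mult_def)
    next
      case False
      then show ?thesis using alt unfolding alternating_form_def interior_mult_def by blast
    qed
    then have "alternation DIM('e) (tensor 1 (\<lambda>ws. b (hd ws)) (interior_mult v \<mu>)) ws = 0"
      by (simp add: alternation_def tensor_def)
    then show ?thesis using that ws * by blast
  next
    case False
    then obtain i where i: "i < DIM('e)" "\<mu> (ws[i := v]) \<noteq> 0"
      using top_form_nonzero_with_entry[OF alt ws] by blast
    then show ?thesis
      using that * covector_wedge_interior_mult_vanishes[OF alt, of "ws[i := v]" i b] len b by simp
  qed
qed

section \<open>Smooth functions on manifolds\<close>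

lemma smooth_on_imp_differentiable: "smooth_on S f \<Longrightarrow> x \<in> S \<Longrightarrow> f differentiable (at x)"
  unfolding smooth_on_def by (metis C_k_on.simps(2))

lemma smooth_on_imp_continuous_derivative:
  "smooth_on S f \<Longrightarrow> continuous_on S (\<lambda>x. frechet_derivative f (at x) v)"
  unfolding smooth_on_def by (metis C_k_on.simps)

lemma smooth_on_imp_continuous: "smooth_on S f \<Longrightarrow> continuous_on S f"
  unfolding smooth_on_def by (metis C_k_on.simps(1))

lemma chart_inv_left: "p \<in> fst c \<Longrightarrow> is_chart c \<Longrightarrow> chart_inv c (snd c p) = p"
  and chart_inv_right: "x \<in> chart_image c \<Longrightarrow> is_chart c \<Longrightarrow> snd c (chart_inv c x) = x"
  and chart_inv_in: "x \<in> chart_image c \<Longrightarrow> is_chart c \<Longrightarrow> chart_inv c x \<in> fst c"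
  by (auto simp: is_chart_def homeomorphism_def)

lemma smooth_function_continuous:
  assumes M: "smooth_manifold A" and f: "smooth_function A f"
  shows "continuous_on UNIV f"
proof -
  have "continuous_on (\<Union>(fst ` A)) f"
  proof (rule continuous_on_open_Union)
    fix S assume "S \<in> fst ` A"
    then obtain c where c: "c \<in> A" "S = fst c" by auto
    then have chart: "is_chart c" using M by (auto simp: smooth_manifold_def)
    then show "open S" using c by (simp add: is_chart_def)
    have "continuous_on (fst c) ((f \<circ> chart_inv c) \<circ> snd c)"
    proof (rule continuous_on_compose)
      show "continuous_on (fst c) (snd c)"
        using chart by (simp add: is_chart_def homeomorphism_def)
      show "continuous_on (snd c ` fst c) (f \<circ> chart_inv c)"
        using f c unfolding smooth_function_def chart_image_def by (blast intro: smooth_on_imp_continuous)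
    qed
    then show "continuous_on S f"
      unfolding c by (rule continuous_on_eq) (simp add: chart chart_inv_left)
  qed
  then show ?thesis using M by (auto simp: smooth_manifold_def)
qed

section \<open>Powers of rescaled contact Hamiltonian forms\<close>

lemma ext_deriv_pair:
  "ext_deriv \<alpha> x [u, v] =
     frechet_derivative (\<lambda>y. \<alpha> y [v]) (at x) u - frechet_derivative (\<lambda>y. \<alpha> y [u]) (at x) v"
  by (simp add: ext_deriv_def)

lemma ext_deriv_rescale:
  assumes "open X" "x \<in> X"
    and h: "h differentiable (at x)"
    and \<alpha>: "\<And>v. (\<lambda>y. \<alpha> y [v]) differentiable (at x)"
    and \<beta>: "\<And>y v. y \<in> X \<Longrightarrow> \<beta> y [v] = h y * \<alpha> y [v]"
  shows "ext_deriv \<beta> x [u, v] = h x * ext_deriv \<alpha> x [u, v] +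
     (frechet_derivative h (at x) u * \<alpha> x [v] - \<alpha> x [u] * frechet_derivative h (at x) v)"
proof -
  have "frechet_derivative (\<lambda>y. \<beta> y [v]) (at x) =
      (\<lambda>u. h x * frechet_derivative (\<lambda>y. \<alpha> y [v]) (at x) u + frechet_derivative h (at x) u * \<alpha> x [v])" for v
  proof -
    have "((\<lambda>y. h y * \<alpha> y [v]) has_derivative
      (\<lambda>u. h x * frechet_derivative (\<lambda>y. \<alpha> y [v]) (at x) u + frechet_derivative h (at x) u * \<alpha> x [v])) (at x)"
      using h \<alpha>[of v] by (intro has_derivative_mult) (auto simp: frechet_derivative_works)
    then have "((\<lambda>y. \<beta> y [v]) has_derivative
      (\<lambda>u. h x * frechet_derivative (\<lambda>y. \<alpha> y [v]) (at x) u + frechet_derivative h (at x) u * \<alpha> x [v])) (at x)"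
      by (rule has_derivative_transform_within_open[OF _ assms(1,2)]) (simp add: \<beta>)
    then show ?thesis by (rule frechet_derivative_at[symmetric])
  qed
  then show ?thesis by (simp add: ext_deriv_pair algebra_simps)
qed

text \<open>The formulas for \<open>(d(f \<alpha>\<^sub>0))\<^sup>k\<^sup>+\<^sup>1\<close> and \<open>f \<alpha>\<^sub>0 \<and> (d(f \<alpha>\<^sub>0))\<^sup>k\<close>, at a point and in a chart. They follow
  from \<open>d(f \<alpha>\<^sub>0) = f d\<alpha>\<^sub>0 + df \<and> \<alpha>\<^sub>0\<close>.\<close>

lemma rescaled_contact_form_powers:
  assumes M: "smooth_manifold A" and c: "c \<in> A" and x: "x \<in> chart_image c"
    and \<alpha>\<^sub>0: "differential_form A 1 \<alpha>\<^sub>0" and f: "smooth_function A f"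
    and \<alpha>: "\<And>p vs. p \<in> fst c \<Longrightarrow> \<alpha> c (snd c p) vs = f p * \<alpha>\<^sub>0 c (snd c p) vs"
  defines "\<omega> \<equiv> ext_deriv (\<alpha>\<^sub>0 c) x" and "h \<equiv> f \<circ> chart_inv c"
  shows "power_form (d_form \<alpha>) (Suc k) c x = (\<lambda>vs. (1/2) ^ Suc k *
      (h x ^ Suc k * alternation (2 * Suc k) (tensor_power \<omega> (Suc k)) vs +
       2 * real (Suc k) * h x ^ k * alternation (2 * Suc k) (tensor 1 (\<lambda>ws. frechet_derivative h (at x) (hd ws))
          (tensor 1 (\<alpha>\<^sub>0 c x) (tensor_power \<omega> k))) vs))" (is ?power)
    and "wedge_form 1 (2 * k) \<alpha> (power_form (d_form \<alpha>) k) c x =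
      (\<lambda>vs. (1/2) ^ k * h x ^ Suc k * alternation (1 + 2 * k) (tensor 1 (\<alpha>\<^sub>0 c x) (tensor_power \<omega> k)) vs)" (is ?wedge)
proof -
  have chart: "is_chart c" using M c by (auto simp: smooth_manifold_def)
  have \<alpha>h: "\<alpha> c y vs = h y * \<alpha>\<^sub>0 c y vs" if "y \<in> chart_image c" for y vs
    using \<alpha>[OF chart_inv_in[OF that chart]] chart_inv_right[OF that chart] by (simp add: h_def)
  have d: "ext_deriv (\<alpha> c) x [u, v] = h x * \<omega> [u, v] +
     (frechet_derivative h (at x) u * \<alpha>\<^sub>0 c x [v] - \<alpha>\<^sub>0 c x [u] * frechet_derivative h (at x) v)" for u v
    unfolding \<omega>_def
  proof (rule ext_deriv_rescale[of "chart_image c"])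
    show "open (chart_image c)" using chart by (simp add: is_chart_def)
    show "h differentiable (at x)"
      unfolding h_def using f c x by (auto simp: smooth_function_def intro: smooth_on_imp_differentiable)
    show "(\<lambda>y. \<alpha>\<^sub>0 c y [v]) differentiable (at x)" for v
      using \<alpha>\<^sub>0 c x unfolding differential_form_def
      by (intro smooth_on_imp_differentiable[of "chart_image c"]) blast+
  qed (use x \<alpha>h in auto)
  let ?b = "\<lambda>ws. frechet_derivative h (at x) (hd ws)"
  show ?power
    unfolding power_form_def d_form_def form2_power_eq_alternation
    by (subst alternation_tensor_power_perturb[of _ "h x" \<omega> ?b "\<alpha>\<^sub>0 c x"]) (simp_all add: d)
  have "tensor 1 (\<alpha> c x) R = (\<lambda>vs. h x * tensor 1 (\<alpha>\<^sub>0 c x) R vs)" for R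
    using \<alpha>h[OF x] by (simp add: tensor_def fun_eq_iff)
  then have "alternation (1 + 2 * k) (tensor 1 (\<alpha> c x) (tensor_power (ext_deriv (\<alpha> c) x) k)) =
     (\<lambda>vs. h x ^ Suc k * alternation (1 + 2 * k) (tensor 1 (\<alpha>\<^sub>0 c x) (tensor_power \<omega> k)) vs)"
    by (simp only: alternation_scale alternation_covector_tensor_power[of "ext_deriv (\<alpha> c) x" "h x" \<omega> ?b "\<alpha>\<^sub>0 c x" k] d list.sel)
      (simp add: mult_ac)
  then show ?wedge
    unfolding wedge_form_def power_form_def d_form_def wedge_form2_power_eq_alternation by (simp add: mult_ac)
qed

lemma pos_class_multiples_of_representative:
  assumes \<eta>: "\<eta> \<in> S // pos_rel A S"
  shows "\<exists>\<alpha>\<^sub>0\<in>S. \<eta> \<subseteq> S \<and> (\<forall>\<alpha>\<in>\<eta>. \<exists>f. smooth_function A f \<and> (\<forall>p. f p > 0) \<and>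
        (\<forall>c\<in>A. \<forall>p\<in>fst c. \<forall>vs. \<alpha> c (snd c p) vs = f p * \<alpha>\<^sub>0 c (snd c p) vs))"
proof -
  from \<eta> obtain \<alpha>\<^sub>0 where "\<alpha>\<^sub>0 \<in> S" "\<eta> = pos_rel A S `` {\<alpha>\<^sub>0}"
    by (rule quotientE)
  then show ?thesis
    by (intro bexI[of _ \<alpha>\<^sub>0]) (auto simp: pos_rel_def)
qed

section \<open>Integral curves\<close>

lemma C1_locally_Lipschitz:
  fixes Z :: "'a::euclidean_space \<Rightarrow> 'b::real_normed_vector"
  assumes "open U" "x \<in> U"
    and diff: "\<And>y. y \<in> U \<Longrightarrow> Z differentiable (at y)"
    and cont: "\<And>v. continuous_on U (\<lambda>y. frechet_derivative Z (at y) v)"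
  obtains r L where "r > 0" "L \<ge> 0" "cball x r \<subseteq> U" "L-lipschitz_on (cball x r) Z"
proof -
  obtain r where r: "r > 0" "cball x r \<subseteq> U"
    using assms(1,2) open_contains_cball by blast
  have "\<exists>B. \<forall>y\<in>cball x r. norm (frechet_derivative Z (at y) v) \<le> B" for v
  proof -
    have "compact ((\<lambda>y. frechet_derivative Z (at y) v) ` cball x r)"
      using continuous_on_subset[OF cont r(2)] by (intro compact_continuous_image) auto
    then show ?thesis
      using compact_imp_bounded by (force simp: bounded_iff)
  qed
  then obtain B where B: "\<And>v y. y \<in> cball x r \<Longrightarrow> norm (frechet_derivative Z (at y) v) \<le> B v"
    by metis
  have der: "(Z has_derivative frechet_derivative Z (at y)) (at y)" if "y \<in> cball x r" for y
    using diff r(2) that by (auto simp: frechet_derivative_works)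
  have on: "onorm (frechet_derivative Z (at y)) \<le> sum B Basis" if y: "y \<in> cball x r" for y
  proof (rule onorm_le)
    fix u :: 'a
    interpret bounded_linear "frechet_derivative Z (at y)"
      using der[OF y] by (rule has_derivative_bounded_linear)
    have "frechet_derivative Z (at y) u = (\<Sum>i\<in>Basis. (u \<bullet> i) *\<^sub>R frechet_derivative Z (at y) i)"
      by (subst euclidean_representation[of u, symmetric]) (simp only: sum scaleR)
    also have "norm \<dots> \<le> (\<Sum>i\<in>Basis. B i * norm u)"
    proof (rule sum_norm_le)
      fix i :: 'a assume "i \<in> Basis"
      then have "\<bar>u \<bullet> i\<bar> * norm (frechet_derivative Z (at y) i) \<le> norm u * B i"
        by (intro mult_mono B[OF y] Basis_le_norm) auto
      then show "norm ((u \<bullet> i) *\<^sub>R frechet_derivative Z (at y) i) \<le> B i * norm u"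
        by (simp add: mult.commute)
    qed
    finally show "norm (frechet_derivative Z (at y) u) \<le> sum B Basis * norm u"
      by (simp add: sum_distrib_right)
  qed
  have "0 \<le> B v" for v
    using B[of x v] r(1) by (meson centre_in_cball less_imp_le norm_ge_zero order_trans)
  then have "sum B Basis \<ge> 0"
    by (intro sum_nonneg) auto
  moreover have "(sum B Basis)-lipschitz_on (cball x r) Z"
  proof (rule lipschitz_onI)
    fix y z assume "y \<in> cball x r" "z \<in> cball x r"
    then show "dist (Z y) (Z z) \<le> sum B Basis * dist y z"
      unfolding dist_norm
      by (intro differentiable_bound[of "cball x r" Z "\<lambda>y. frechet_derivative Z (at y)"] on
          has_derivative_at_withinI[OF der]) auto
  qed fact
  ultimately show ?thesis using that r by blast
qed

text \<open>Two devices turn this into a fixed point problem on the complete space of all bounded continuous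
  functions on the real line: the field is extended from the ball to the whole space by
  composing it with the nearest point projection, which keeps the Lipschitz constant, and time is clamped
  to \<open>[-\<epsilon>, \<epsilon>]\<close>. The solution stays in the ball, where the extension agrees with the field.\<close>

lemma Picard_Lindelof:
  fixes Z :: "'e::euclidean_space \<Rightarrow> 'e"
  assumes "r > 0" "L \<ge> 0" and lip: "L-lipschitz_on (cball x r) Z"
  obtains \<epsilon> \<phi> where "\<epsilon> > 0" "\<phi> 0 = x"
    "\<And>t. \<bar>t\<bar> < \<epsilon> \<Longrightarrow> \<phi> t \<in> cball x r \<and> (\<phi> has_vector_derivative Z (\<phi> t)) (at t)"
proof -
  define M where "M = norm (Z x) + L * r"
  define W where "W = Z \<circ> closest_point (cball x r)"
  have cp: "closest_point (cball x r) z \<in> cball x r" for z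
    using \<open>r > 0\<close> by (intro closest_point_in_set) auto
  have W_lip: "dist (W y) (W z) \<le> L * dist y z" for y z
  proof -
    have "dist (W y) (W z) \<le> L * dist (closest_point (cball x r) y) (closest_point (cball x r) z)"
      unfolding W_def o_def by (rule lipschitz_onD[OF lip]) (rule cp)+
    also have "\<dots> \<le> L * dist y z"
      using \<open>r > 0\<close> \<open>L \<ge> 0\<close> by (intro mult_left_mono closest_point_lipschitz) auto
    finally show ?thesis .
  qed
  have W_bound: "norm (W y) \<le> M" for y
  proof -
    have "dist (W y) (Z x) \<le> L * dist (closest_point (cball x r) y) x"
      unfolding W_def o_def using \<open>r > 0\<close> by (intro lipschitz_onD[OF lip] cp) auto
    also have "\<dots> \<le> L * r"
      using cp[of y] \<open>L \<ge> 0\<close> by (intro mult_left_mono) (auto simp: dist_commute)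
    finally show ?thesis
      unfolding M_def dist_norm using norm_triangle_ineq2[of "W y" "Z x"] by linarith
  qed
  have M: "M \<ge> 0"
    using \<open>r > 0\<close> \<open>L \<ge> 0\<close> by (simp add: M_def)
  have W_cont: "continuous_on S W" for S
    using W_lip \<open>L \<ge> 0\<close>
    by (intro lipschitz_on_continuous_on[of L] lipschitz_onI) auto
  \<comment> \<open>The integrals below run over at most \<open>2 \<epsilon>\<close> and occur in pairs, so \<open>4 \<epsilon> M \<le> r\<close> keeps the iterates
    in the ball and \<open>4 \<epsilon> L \<le> 1/2\<close> makes the iteration a contraction.\<close>
  define \<epsilon> where "\<epsilon> = min (r / (4 * (M + 1))) (1 / (8 * (L + 1)))"
  have \<epsilon>: "\<epsilon> > 0" "4 * \<epsilon> * M \<le> r" "4 * \<epsilon> * L \<le> 1/2"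
  proof -
    show "\<epsilon> > 0"
      using \<open>r > 0\<close> \<open>L \<ge> 0\<close> M by (simp add: \<epsilon>_def)
    have "\<epsilon> * (4 * (M + 1)) \<le> r" "\<epsilon> * (8 * (L + 1)) \<le> 1"
      using \<open>L \<ge> 0\<close> M unfolding \<epsilon>_def
      by (auto simp: min_le_iff_disj pos_le_divide_eq[symmetric])
    then show "4 * \<epsilon> * M \<le> r" "4 * \<epsilon> * L \<le> 1/2"
      using \<open>\<epsilon> > 0\<close> by (auto simp: algebra_simps)
  qed
  define clamp where "clamp t = max (-\<epsilon>) (min \<epsilon> t)" for t :: real
  define G where "G \<phi> t = integral {-\<epsilon>..t} (\<lambda>s. W (\<phi> s))" for \<phi> :: "real \<Rightarrow> 'e" and t
  \<comment> \<open>Subtracting the value at \<open>0\<close> yields the integral from \<open>0\<close> to \<open>t\<close> for both signs of \<open>t\<close>.\<close>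
  define T where "T \<phi> t = x + G \<phi> (clamp t) - G \<phi> 0" for \<phi> :: "real \<Rightarrow> 'e" and t
  have clamp: "clamp t \<in> {-\<epsilon>..\<epsilon>}" for t
    using \<epsilon>(1) by (auto simp: clamp_def)
  have W\<phi>: "continuous_on S (\<lambda>s. W (apply_bcontfun \<phi> s))" for \<phi> :: "real \<Rightarrow>\<^sub>C 'e" and S
    using continuous_on_compose2[OF W_cont continuous_on_apply_bcontfun] by blast
  have int: "(\<lambda>s. W (apply_bcontfun \<phi> s)) integrable_on {-\<epsilon>..t}" for \<phi> t
    by (intro integrable_continuous_real W\<phi>)
  have G_bound: "norm (G \<phi> t) \<le> 2 * \<epsilon> * M" if "t \<in> {-\<epsilon>..\<epsilon>}" for \<phi> :: "real \<Rightarrow>\<^sub>C 'e" and t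
  proof -
    have "norm (G \<phi> t) \<le> M * (t - (-\<epsilon>))"
      unfolding G_def using that W_bound W\<phi> by (intro integral_bound) auto
    also have "\<dots> \<le> M * (2 * \<epsilon>)"
      using that M by (intro mult_left_mono) auto
    finally show ?thesis by (simp add: mult_ac)
  qed
  have G_dist: "norm (G \<phi> t - G \<psi> t) \<le> 2 * \<epsilon> * L * dist \<phi> \<psi>" if "t \<in> {-\<epsilon>..\<epsilon>}" for \<phi> \<psi> :: "real \<Rightarrow>\<^sub>C 'e" and t
  proof -
    have "G \<phi> t - G \<psi> t = integral {-\<epsilon>..t} (\<lambda>s. W (\<phi> s) - W (\<psi> s))"
      unfolding G_def by (rule Henstock_Kurzweil_Integration.integral_diff[symmetric]) (rule int)+
    also have "norm \<dots> \<le> (L * dist \<phi> \<psi>) * (t - (-\<epsilon>))"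
    proof (rule integral_bound)
      show "norm (W (\<phi> s) - W (\<psi> s)) \<le> L * dist \<phi> \<psi>" for s
        using W_lip[of "\<phi> s" "\<psi> s"] mult_left_mono[OF dist_bounded[of \<phi> s \<psi>] \<open>L \<ge> 0\<close>]
        by (simp add: dist_norm)
    qed (use that W\<phi> in \<open>auto intro!: continuous_on_diff\<close>)
    also have "\<dots> \<le> (L * dist \<phi> \<psi>) * (2 * \<epsilon>)"
      using that \<open>L \<ge> 0\<close> by (intro mult_left_mono) auto
    finally show ?thesis by (simp add: mult_ac)
  qed
  have T_near: "dist (T \<phi> t) x \<le> r" for \<phi> :: "real \<Rightarrow>\<^sub>C 'e" and t
  proof -
    have "dist (T \<phi> t) x \<le> norm (G \<phi> (clamp t)) + norm (G \<phi> 0)"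
      unfolding T_def dist_norm using norm_triangle_ineq4[of "G \<phi> (clamp t)" "G \<phi> 0"]
      by (simp add: algebra_simps)
    also have "\<dots> \<le> 2 * \<epsilon> * M + 2 * \<epsilon> * M"
      using clamp \<epsilon>(1) by (intro add_mono G_bound) auto
    also have "\<dots> \<le> r" using \<epsilon>(2) by (simp add: mult_ac)
    finally show ?thesis .
  qed
  have T_bcontfun: "T \<phi> \<in> bcontfun" for \<phi> :: "real \<Rightarrow>\<^sub>C 'e"
  proof -
    have "continuous_on {-\<epsilon>..\<epsilon>} (G \<phi>)"
      unfolding G_def by (rule indefinite_integral_continuous_1) (rule int)
    moreover have "continuous_on UNIV clamp"
      unfolding clamp_def by (intro continuous_intros)
    ultimately have "continuous_on UNIV (\<lambda>t. G \<phi> (clamp t))"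
      by (rule continuous_on_compose2) (use clamp in auto)
    then have "continuous_on UNIV (T \<phi>)"
      unfolding T_def by (intro continuous_intros)
    moreover have "bounded (range (T \<phi>))"
      using T_near by (auto simp: bounded_def dist_commute intro!: exI[of _ x] exI[of _ r])
    ultimately show ?thesis by (simp add: bcontfun_def)
  qed
  define F where "F \<phi> = Bcontfun (T \<phi>)" for \<phi> :: "real \<Rightarrow>\<^sub>C 'e"
  have F: "apply_bcontfun (F \<phi>) = T \<phi>" for \<phi>
    unfolding F_def by (rule Bcontfun_inverse[OF T_bcontfun])
  have "\<exists>!\<phi> :: real \<Rightarrow>\<^sub>C 'e. F \<phi> = \<phi>"
  proof (rule banach_fix_type[of "1/2"])
    show "\<forall>\<phi> \<psi> :: real \<Rightarrow>\<^sub>C 'e. dist (F \<phi>) (F \<psi>) \<le> 1/2 * dist \<phi> \<psi>"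
    proof (intro allI dist_bound)
      fix \<phi> \<psi> :: "real \<Rightarrow>\<^sub>C 'e" and t
      have "T \<phi> t - T \<psi> t = (G \<phi> (clamp t) - G \<psi> (clamp t)) - (G \<phi> 0 - G \<psi> 0)"
        by (simp add: T_def)
      then have "dist (F \<phi> t) (F \<psi> t) \<le> norm (G \<phi> (clamp t) - G \<psi> (clamp t)) + norm (G \<phi> 0 - G \<psi> 0)"
        unfolding F dist_norm by (metis norm_triangle_ineq4)
      also have "\<dots> \<le> 2 * \<epsilon> * L * dist \<phi> \<psi> + 2 * \<epsilon> * L * dist \<phi> \<psi>"
        using clamp \<epsilon>(1) by (intro add_mono G_dist) auto
      also have "\<dots> = (4 * \<epsilon> * L) * dist \<phi> \<psi>" by simp
      also have "\<dots> \<le> 1/2 * dist \<phi> \<psi>"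
        by (intro mult_right_mono \<epsilon>) auto
      finally show "dist (F \<phi> t) (F \<psi> t) \<le> 1/2 * dist \<phi> \<psi>" .
    qed
  qed auto
  then obtain \<phi> :: "real \<Rightarrow>\<^sub>C 'e" where "F \<phi> = \<phi>" by blast
  then have fixpoint: "apply_bcontfun \<phi> = T \<phi>" using F by metis
  have "apply_bcontfun \<phi> 0 = x"
    using \<epsilon>(1) by (subst fixpoint) (simp add: T_def clamp_def)
  moreover have "\<phi> t \<in> cball x r \<and> (apply_bcontfun \<phi> has_vector_derivative Z (\<phi> t)) (at t)" if t: "\<bar>t\<bar> < \<epsilon>" for t
  proof
    show ball: "\<phi> t \<in> cball x r"
      using T_near[of \<phi> t] by (subst fixpoint) (simp add: dist_commute)
    have "((\<lambda>u. integral {-\<epsilon>..u} (\<lambda>s. W (\<phi> s))) has_vector_derivative W (\<phi> t)) (at t within {-\<epsilon>..\<epsilon>})"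
      using t by (intro integral_has_vector_derivative W\<phi>) auto
    then have "(G \<phi> has_vector_derivative W (\<phi> t)) (at t)"
      using t at_within_interior[of t "{-\<epsilon>..\<epsilon>}"] unfolding G_def[abs_def] by (auto simp: interior_atLeastAtMost_real abs_less_iff)
    then have "((\<lambda>u. (x - G \<phi> 0) + G \<phi> u) has_vector_derivative W (\<phi> t)) (at t)"
      by (auto intro!: derivative_eq_intros)
    then have "(apply_bcontfun \<phi> has_vector_derivative W (\<phi> t)) (at t)"
    proof (rule has_vector_derivative_transform_within_open[where S = "{-\<epsilon><..<\<epsilon>}"])
      show "x - G \<phi> 0 + G \<phi> u = \<phi> u" if "u \<in> {-\<epsilon><..<\<epsilon>}" for u
        using that by (subst (3) fixpoint) (simp add: T_def clamp_def)
    qed (use t in auto)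
    moreover have "W (\<phi> t) = Z (\<phi> t)"
      using ball by (simp add: W_def closest_point_self)
    ultimately show "(apply_bcontfun \<phi> has_vector_derivative Z (\<phi> t)) (at t)" by simp
  qed
  ultimately show ?thesis using that \<epsilon>(1) by blast
qed

text \<open>The curve is constructed in one chart. In any other chart it solves the equation as well, because
  the representations of the field correspond under the transition maps.\<close>

lemma integral_curve_exists:
  assumes M: "smooth_manifold A" and Z: "vector_field A Z"
    and c: "c \<in> A" and p: "p \<in> fst c"
  obtains I \<gamma> where "integral_curve A Z I \<gamma>" "0 \<in> I" "\<gamma> 0 = p" "\<gamma> ` I \<subseteq> fst c"
proof -
  have chart: "is_chart d" if "d \<in> A" for d
    using M that by (auto simp: smooth_manifold_def)
  have op: "open (chart_image c)"
    using chart[OF c] by (simp add: is_chart_def)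
  have x: "snd c p \<in> chart_image c"
    using p by (simp add: chart_image_def)
  have sm: "smooth_on (chart_image c) (Z c)"
    using Z c by (simp add: vector_field_def)
  obtain r L where rL: "r > 0" "L \<ge> 0" "cball (snd c p) r \<subseteq> chart_image c" "L-lipschitz_on (cball (snd c p) r) (Z c)"
    using C1_locally_Lipschitz[OF op x smooth_on_imp_differentiable[OF sm]
        smooth_on_imp_continuous_derivative[OF sm]] by blast
  obtain \<epsilon> \<phi> where \<epsilon>: "\<epsilon> > 0" "\<phi> 0 = snd c p"
    and \<phi>: "\<And>t. \<bar>t\<bar> < \<epsilon> \<Longrightarrow> \<phi> t \<in> cball (snd c p) r \<and> (\<phi> has_vector_derivative Z c (\<phi> t)) (at t)"
    using Picard_Lindelof[OF rL(1,2,4)] by blast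
  define I where "I = {-\<epsilon><..<\<epsilon>}"
  define \<gamma> where "\<gamma> = chart_inv c \<circ> \<phi>"
  have \<phi>_in: "\<phi> t \<in> chart_image c" if "t \<in> I" for t
    using \<phi>[of t] that rL(3) by (auto simp: I_def)
  have \<phi>_der: "(\<phi> has_vector_derivative Z c (\<phi> t)) (at t)" if "t \<in> I" for t
    using \<phi>[of t] that by (auto simp: I_def)
  have \<gamma>_in: "\<gamma> t \<in> fst c" and snd_\<gamma>: "snd c (\<gamma> t) = \<phi> t" if "t \<in> I" for t
    using \<phi>_in[OF that] chart[OF c] by (auto simp: \<gamma>_def chart_inv_in chart_inv_right)
  have "continuous_on I \<phi>"
    using \<phi>_der by (meson continuous_at_imp_continuous_on has_vector_derivative_continuous)
  then have cont: "continuous_on I \<gamma>"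
    unfolding \<gamma>_def using chart[OF c] \<phi>_in
    by (intro continuous_on_compose)
      (auto simp: is_chart_def homeomorphism_def intro: continuous_on_subset)
  have "((snd d \<circ> \<gamma>) has_vector_derivative Z d (snd d (\<gamma> t))) (at t)"
    if t: "t \<in> I" and d: "d \<in> A" and td: "\<gamma> t \<in> fst d" for t d
  proof -
    let ?\<tau> = "transition c d"
    have \<phi>t: "\<phi> t \<in> snd c ` (fst c \<inter> fst d)"
      using \<gamma>_in[OF t] td snd_\<gamma>[OF t] by force
    have "smooth_on (snd c ` (fst c \<inter> fst d)) ?\<tau>"
      using M c d by (auto simp: smooth_manifold_def)
    then have "(?\<tau> has_derivative frechet_derivative ?\<tau> (at (\<phi> t))) (at (\<phi> t))"
      using smooth_on_imp_differentiable[OF _ \<phi>t] frechet_derivative_works by blast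
    from vector_derivative_diff_chain_within[OF \<phi>_der[OF t] has_derivative_at_withinI[OF this]]
    have "((?\<tau> \<circ> \<phi>) has_vector_derivative frechet_derivative ?\<tau> (at (\<phi> t)) (Z c (\<phi> t))) (at t)" .
    moreover have "?\<tau> \<circ> \<phi> = snd d \<circ> \<gamma>"
      by (simp add: transition_def \<gamma>_def comp_assoc)
    moreover have "frechet_derivative ?\<tau> (at (\<phi> t)) (Z c (\<phi> t)) = Z d (?\<tau> (\<phi> t))"
      using Z c d \<phi>t unfolding vector_field_def by metis
    moreover have "?\<tau> (\<phi> t) = snd d (\<gamma> t)"
      by (simp add: transition_def \<gamma>_def)
    ultimately show ?thesis by simp
  qed
  then have "integral_curve A Z I \<gamma>"
    using cont by (auto simp: integral_curve_def I_def)
  moreover have "\<gamma> 0 = p" "0 \<in> I" "\<gamma> ` I \<subseteq> fst c"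
    using \<epsilon> chart[OF c] p \<gamma>_in by (auto simp: \<gamma>_def I_def chart_inv_left)
  ultimately show ?thesis using that by blast
qed

text \<open>Invariance keeps the integral curve through \<open>p\<close> inside \<open>\<Lambda>\<close>, so \<open>f\<close> restricted to this curve has an
  interior local minimum at \<open>p\<close>.\<close>

lemma derivative_zero_at_minimum_on_invariant_set:
  assumes M: "smooth_manifold A" and Z: "vector_field A Z"
    and inv: "\<And>I \<gamma>. integral_curve A Z I \<gamma> \<Longrightarrow> \<gamma> ` I \<inter> \<Lambda> \<noteq> {} \<Longrightarrow> \<gamma> ` I \<subseteq> \<Lambda>"
    and c: "c \<in> A" and p: "p \<in> fst c" "p \<in> \<Lambda>"
    and min: "\<And>q. q \<in> \<Lambda> \<Longrightarrow> f p \<le> f q"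
    and D: "((f \<circ> chart_inv c) has_derivative D) (at (snd c p))"
  shows "D (Z c (snd c p)) = (0::real)"
proof -
  obtain I \<gamma> where \<gamma>: "integral_curve A Z I \<gamma>" "0 \<in> I" "\<gamma> 0 = p" "\<gamma> ` I \<subseteq> fst c"
    using integral_curve_exists[OF M Z c p(1)] by blast
  have chart: "is_chart c" using M c by (auto simp: smooth_manifold_def)
  have \<Lambda>: "\<gamma> t \<in> \<Lambda>" if "t \<in> I" for t
    using inv[OF \<gamma>(1)] \<gamma>(2,3) p(2) that by blast
  have I: "open I" using \<gamma>(1) by (simp add: integral_curve_def)
  have "((snd c \<circ> \<gamma>) has_vector_derivative Z c (snd c p)) (at 0)"
    using \<gamma> c p by (force simp: integral_curve_def)
  moreover have "((f \<circ> chart_inv c) has_derivative D) (at ((snd c \<circ> \<gamma>) 0))"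
    using D \<gamma>(3) by simp
  ultimately have "(((f \<circ> chart_inv c) \<circ> (snd c \<circ> \<gamma>)) has_vector_derivative D (Z c (snd c p))) (at 0)"
    using vector_derivative_diff_chain_within has_derivative_at_withinI by blast
  then have "((f \<circ> \<gamma>) has_vector_derivative D (Z c (snd c p))) (at 0)"
    by (rule has_vector_derivative_transform_within_open[OF _ I \<gamma>(2)])
      (use \<gamma>(4) chart in \<open>auto simp: chart_inv_left image_subset_iff\<close>)
  then have "DERIV (f \<circ> \<gamma>) 0 :> D (Z c (snd c p))"
    by (simp add: has_real_derivative_iff_has_vector_derivative)
  moreover obtain d where "d > 0" "ball 0 d \<subseteq> I"
    using I \<gamma>(2) open_contains_ball by blast
  moreover have "\<forall>t. \<bar>0 - t\<bar> < d \<longrightarrow> (f \<circ> \<gamma>) 0 \<le> (f \<circ> \<gamma>) t"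
    using \<open>ball 0 d \<subseteq> I\<close> \<gamma>(3) min \<Lambda> by (auto simp: subset_iff dist_real_def)
  ultimately show ?thesis
    using DERIV_local_min by blast
qed

section \<open>Positive and negative invariant sets\<close>

theorem lemma3p8:
  fixes A :: "('m::{t2_space, second_countable_topology}, 'e::euclidean_space) chart set"
    and ori \<eta> :: "('m, 'e) dform set"
    and n :: nat
    and \<Lambda> :: "'m set"
  assumes "smooth_manifold A"
    and "DIM('e) = 2 * n"
    and "orientation A ori"
    and "contact_Hamiltonian_structure A n \<eta>"
    and "\<Lambda> \<noteq> {}"
    and "compact \<Lambda>"
    and "invariant_set A (characteristic_foliation A ori n \<eta>) \<Lambda>"
    and "Liouville_set A \<eta> \<Lambda>"
  shows "\<not> (positive_set A ori n \<eta> \<Lambda> \<and> negative_set A ori n \<eta> \<Lambda>)"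
proof
  assume "positive_set A ori n \<eta> \<Lambda> \<and> negative_set A ori n \<eta> \<Lambda>"
  then obtain \<alpha>\<^sub>1 U\<^sub>1 \<alpha>\<^sub>2 U\<^sub>2 where \<alpha>\<^sub>1: "\<alpha>\<^sub>1 \<in> \<eta>" "\<Lambda> \<subseteq> U\<^sub>1"
      "induces_orientation_on A ori U\<^sub>1 (power_form (d_form \<alpha>\<^sub>1) n)"
    and \<alpha>\<^sub>2: "\<alpha>\<^sub>2 \<in> \<eta>" "\<Lambda> \<subseteq> U\<^sub>2"
      "induces_orientation_on A (opposite ori) U\<^sub>2 (power_form (d_form \<alpha>\<^sub>2) n)"
    unfolding negative_set_def positive_set_def by blast
  obtain k where n: "n = Suc k"
    using assms(2) DIM_positive[where 'a = 'e] by (cases n) auto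
  obtain Z where "Z \<in> characteristic_foliation A ori n \<eta>"
    and inv: "\<forall>I \<gamma>. integral_curve A Z I \<gamma> \<and> \<gamma> ` I \<inter> \<Lambda> \<noteq> {} \<longrightarrow> \<gamma> ` I \<subseteq> \<Lambda>"
    using assms(7) unfolding invariant_set_def by (elim bexE)
  then obtain \<alpha> \<mu> where Z: "vector_field A Z" and \<alpha>: "\<alpha> \<in> \<eta>" and \<mu>: "\<mu> \<in> ori"
    and Z_char: "\<forall>c\<in>A. \<forall>x\<in>chart_image c.
      interior_mult (Z c x) (\<mu> c x) = wedge_form 1 (2 * k) \<alpha> (power_form (d_form \<alpha>) k) c x"
    unfolding characteristic_foliation_def n diff_Suc_1 by blast
  obtain \<alpha>\<^sub>0 where \<alpha>\<^sub>0: "\<alpha>\<^sub>0 \<in> contact_Hamiltonian_forms A n"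
    and \<alpha>\<^sub>0_class: "\<forall>\<alpha>\<in>\<eta>. \<exists>f. smooth_function A f \<and> (\<forall>p. f p > 0) \<and>
        (\<forall>c\<in>A. \<forall>p\<in>fst c. \<forall>vs. \<alpha> c (snd c p) vs = f p * \<alpha>\<^sub>0 c (snd c p) vs)"
    using pos_class_multiples_of_representative[OF assms(4)[unfolded contact_Hamiltonian_structure_def]]
    by (elim bexE conjE)
  have \<alpha>\<^sub>0_form: "differential_form A 1 \<alpha>\<^sub>0"
    using \<alpha>\<^sub>0 by (simp add: contact_Hamiltonian_forms_def)
  have \<mu>_vol: "\<mu> \<in> volume_forms A"
    using pos_class_multiples_of_representative[OF assms(3)[unfolded orientation_def]] \<mu>
    by (elim bexE conjE) (rule subsetD)
  obtain f where f: "smooth_function A f" "\<And>p. f p > 0"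
    "\<And>c p vs. c \<in> A \<Longrightarrow> p \<in> fst c \<Longrightarrow> \<alpha> c (snd c p) vs = f p * \<alpha>\<^sub>0 c (snd c p) vs"
    using bspec[OF \<alpha>\<^sub>0_class \<alpha>] by blast
  obtain f\<^sub>1 where f\<^sub>1: "smooth_function A f\<^sub>1" "\<And>p. f\<^sub>1 p > 0"
    "\<And>c p vs. c \<in> A \<Longrightarrow> p \<in> fst c \<Longrightarrow> \<alpha>\<^sub>1 c (snd c p) vs = f\<^sub>1 p * \<alpha>\<^sub>0 c (snd c p) vs"
    using bspec[OF \<alpha>\<^sub>0_class \<alpha>\<^sub>1(1)] by blast
  obtain f\<^sub>2 where f\<^sub>2: "smooth_function A f\<^sub>2" "\<And>p. f\<^sub>2 p > 0"
    "\<And>c p vs. c \<in> A \<Longrightarrow> p \<in> fst c \<Longrightarrow> \<alpha>\<^sub>2 c (snd c p) vs = f\<^sub>2 p * \<alpha>\<^sub>0 c (snd c p) vs"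
    using bspec[OF \<alpha>\<^sub>0_class \<alpha>\<^sub>2(1)] by blast
  have "f\<^sub>2 q \<noteq> 0" for q
    using f\<^sub>2(2)[of q] by simp
  then have "continuous_on \<Lambda> (\<lambda>p. f\<^sub>1 p / f\<^sub>2 p)"
    using smooth_function_continuous[OF assms(1)] f\<^sub>1(1) f\<^sub>2(1)
    by (intro continuous_on_divide) (auto intro: continuous_on_subset)
  then obtain p where p: "p \<in> \<Lambda>" "\<And>q. q \<in> \<Lambda> \<Longrightarrow> f\<^sub>1 p / f\<^sub>2 p \<le> f\<^sub>1 q / f\<^sub>2 q"
    using continuous_attains_inf[OF assms(6,5)] by blast
  obtain c where c: "c \<in> A" "p \<in> fst c"
    using assms(1) unfolding smooth_manifold_def by blast
  then have chart: "is_chart c" using assms(1) by (auto simp: smooth_manifold_def)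
  define x where "x = snd c p"
  have x: "x \<in> chart_image c" "chart_inv c x = p"
    using c chart by (auto simp: x_def chart_image_def chart_inv_left)
  define h\<^sub>1 where "h\<^sub>1 = f\<^sub>1 \<circ> chart_inv c"
  define h\<^sub>2 where "h\<^sub>2 = f\<^sub>2 \<circ> chart_inv c"
  define D\<^sub>1 where "D\<^sub>1 = frechet_derivative h\<^sub>1 (at x)"
  define D\<^sub>2 where "D\<^sub>2 = frechet_derivative h\<^sub>2 (at x)"
  have D\<^sub>1: "(h\<^sub>1 has_derivative D\<^sub>1) (at x)"
    unfolding D\<^sub>1_def frechet_derivative_works[symmetric] h\<^sub>1_def
    using f\<^sub>1(1) c(1) x(1) by (auto simp: smooth_function_def intro: smooth_on_imp_differentiable)
  have D\<^sub>2: "(h\<^sub>2 has_derivative D\<^sub>2) (at x)"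
    unfolding D\<^sub>2_def frechet_derivative_works[symmetric] h\<^sub>2_def
    using f\<^sub>2(1) c(1) x(1) by (auto simp: smooth_function_def intro: smooth_on_imp_differentiable)
  have h: "h\<^sub>1 x > 0" "h\<^sub>2 x > 0"
    using f\<^sub>1(2) f\<^sub>2(2) by (auto simp: h\<^sub>1_def h\<^sub>2_def)
  \<comment> \<open>Up to the factor \<open>1 / f\<^sub>2\<^sup>2\<close> this is the differential of \<open>f\<^sub>1 / f\<^sub>2\<close>.\<close>
  define b where "b u = h\<^sub>2 x * D\<^sub>1 u + (- h\<^sub>1 x) * D\<^sub>2 u" for u
  have "((\<lambda>y. h\<^sub>1 y / h\<^sub>2 y) has_derivative (\<lambda>u. b u / (h\<^sub>2 x * h\<^sub>2 x))) (at x)"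
    using has_derivative_divide'[OF D\<^sub>1 D\<^sub>2] h by (simp add: b_def mult_ac)
  then have "(((\<lambda>p. f\<^sub>1 p / f\<^sub>2 p) \<circ> chart_inv c) has_derivative (\<lambda>u. b u / (h\<^sub>2 x * h\<^sub>2 x))) (at (snd c p))"
    by (simp add: h\<^sub>1_def h\<^sub>2_def o_def x_def)
  from derivative_zero_at_minimum_on_invariant_set[OF assms(1) Z _ c p(1) _ this] p(2) inv
  have b: "b (Z c x) = 0"
    using h by (simp add: x_def)
  let ?\<omega> = "ext_deriv (\<alpha>\<^sub>0 c) x"
  define T where "T = tensor 1 (\<alpha>\<^sub>0 c x) (tensor_power ?\<omega> k)"
  define W where "W = alternation (2 * n) (tensor_power ?\<omega> n)"
  define X where "X D = alternation (2 * n) (tensor 1 (\<lambda>ws. D (hd ws)) T)" for D :: "'e \<Rightarrow> real"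
  have \<mu>_alt: "alternating_form DIM('e) (\<mu> c x)" and \<mu>_nz: "\<mu> c x \<noteq> (\<lambda>_. 0)"
    using \<mu>_vol c(1) x(1) by (auto simp: volume_forms_def differential_form_def)
  have "interior_mult (Z c x) (\<mu> c x) =
      (\<lambda>vs. ((1/2) ^ k * f p ^ Suc k) * alternation (1 + 2 * k) T vs)"
    unfolding bspec[OF bspec[OF Z_char c(1)] x(1)] T_def
    using rescaled_contact_form_powers(2)[OF assms(1) c(1) x(1) \<alpha>\<^sub>0_form f(1), of \<alpha> k] f(3)[OF c(1)] x(2)
    by simp
  moreover have "(1/2) ^ k * f p ^ Suc k \<noteq> 0"
    using f(2)[of p] by simp
  moreover have "DIM('e) = 1 + (1 + 2 * k)"
    using assms(2) n by simp
  ultimately obtain vs where "\<mu> c x vs \<noteq> 0" "alternation DIM('e) (tensor 1 (\<lambda>ws. b (hd ws)) T) vs = 0"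
    by (rule alternation_covector_characteristic_vanishes[where b = b, OF \<mu>_alt \<mu>_nz b])
  then have vs: "\<mu> c x vs \<noteq> 0" "X b vs = 0"
    unfolding X_def assms(2) .
  have "X b = (\<lambda>vs. h\<^sub>2 x * X D\<^sub>1 vs + (- h\<^sub>1 x) * X D\<^sub>2 vs)"
    unfolding X_def b_def tensor_lincomb_left alternation_lincomb by simp
  with vs(2) have X: "h\<^sub>2 x * X D\<^sub>1 vs = h\<^sub>1 x * X D\<^sub>2 vs" by simp
  obtain a\<^sub>1 where a\<^sub>1: "a\<^sub>1 > 0" "power_form (d_form \<alpha>\<^sub>1) n c x vs = a\<^sub>1 * \<mu> c x vs"
    using \<alpha>\<^sub>1(2,3) \<mu> c p(1) unfolding induces_orientation_on_def x_def by blast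
  obtain a\<^sub>2 where a\<^sub>2: "a\<^sub>2 > 0" "power_form (d_form \<alpha>\<^sub>2) n c x vs = a\<^sub>2 * - \<mu> c x vs"
    using bspec[OF \<alpha>\<^sub>2(3)[unfolded induces_orientation_on_def], of "\<lambda>c x vs. - \<mu> c x vs"]
      \<alpha>\<^sub>2(2) \<mu> c p(1) unfolding opposite_def x_def by blast
  have P\<^sub>1: "a\<^sub>1 * \<mu> c x vs = (1/2) ^ n * (h\<^sub>1 x ^ Suc k * W vs + 2 * real n * h\<^sub>1 x ^ k * X D\<^sub>1 vs)"
    using rescaled_contact_form_powers(1)[where \<alpha> = \<alpha>\<^sub>1 and k = k,
        OF assms(1) c(1) x(1) \<alpha>\<^sub>0_form f\<^sub>1(1) f\<^sub>1(3)[OF c(1)]] a\<^sub>1(2)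
    unfolding W_def X_def T_def D\<^sub>1_def h\<^sub>1_def n by simp
  have P\<^sub>2: "a\<^sub>2 * - \<mu> c x vs = (1/2) ^ n * (h\<^sub>2 x ^ Suc k * W vs + 2 * real n * h\<^sub>2 x ^ k * X D\<^sub>2 vs)"
    using rescaled_contact_form_powers(1)[where \<alpha> = \<alpha>\<^sub>2 and k = k,
        OF assms(1) c(1) x(1) \<alpha>\<^sub>0_form f\<^sub>2(1) f\<^sub>2(3)[OF c(1)]] a\<^sub>2(2)
    unfolding W_def X_def T_def D\<^sub>2_def h\<^sub>2_def n by simp
  \<comment> \<open>Eliminating \<open>W\<close>, the coefficient of \<open>(d\<alpha>\<^sub>0)\<^sup>n\<close>; by \<open>X\<close> the remaining terms agree.\<close>
  have "h\<^sub>2 x ^ Suc k * (a\<^sub>1 * \<mu> c x vs) = h\<^sub>1 x ^ Suc k * (a\<^sub>2 * - \<mu> c x vs)"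
  proof -
    have "h\<^sub>2 x ^ Suc k * (h\<^sub>1 x ^ k * X D\<^sub>1 vs) = h\<^sub>2 x ^ k * h\<^sub>1 x ^ k * (h\<^sub>2 x * X D\<^sub>1 vs)"
      by (simp add: mult_ac)
    also have "\<dots> = h\<^sub>1 x ^ Suc k * (h\<^sub>2 x ^ k * X D\<^sub>2 vs)"
      unfolding X by (simp add: mult_ac)
    finally show ?thesis
      unfolding P\<^sub>1 P\<^sub>2 by (simp add: algebra_simps)
  qed
  then have "(h\<^sub>2 x ^ Suc k * a\<^sub>1 + h\<^sub>1 x ^ Suc k * a\<^sub>2) * \<mu> c x vs = 0"
    by (simp add: algebra_simps)
  moreover have "h\<^sub>2 x ^ Suc k * a\<^sub>1 + h\<^sub>1 x ^ Suc k * a\<^sub>2 > 0"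
    using h a\<^sub>1(1) a\<^sub>2(1) by (intro add_pos_pos mult_pos_pos zero_less_power)
  ultimately show False
    using vs(1) by simp
qed

end
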